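(* Let $R$ be a commutative ring with nonzero identity. The following statements are equivalent. (1) $R$ is a general $ZPI$-ring. (2) $R$ is an arithmetical $OAF$-ring. (3) $R$ is an arithmetical ring and each proper principal ideal of $R$ has an $OA$-factorization.
   Context: All rings are commutative with nonzero identity. An ideal $I$ of a ring $R$ is proper if $I\neq R$. A proper ideal $I$ of $R$ is an $OA$-ideal ($1$-absorbing prime ideal) if whenever $a,b,c\in R$ are nonunits with $abc\in I$, then $ab\in I$ or $c\in I$. An $OA$-factorization of a proper ideal $I$ is an expression $I=\prod_{i=1}^n J_i$ ($n\ge 1$) as a product of $OA$-ideals $J_i$. A ring is an $OAF$-ring if every proper ideal has an $OA$-factorization. A ring is a general $ZPI$-ring if every proper ideal is a finite product of prime ideals. A ring is a chained ring if any two of its ideals are comparable under inclusion. A ring $R$ is arithmetical if $R_M$ is a chained ring for each maximal ideal $M$ of $R$. *)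

theory Defs
  imports "HOL-Algebra.Ideal_Product"
begin

section \<open>Localization\<close>

text \<open>The classes are the fractions \<open>a/s\<close> with \<open>a \<in> R\<close> and \<open>s \<in> S\<close>. The extra factor \<open>u\<close> is
  needed because \<open>S\<close> may contain zero divisors.\<close>

definition frac_rel :: "('a, 'b) ring_scheme \<Rightarrow> 'a set \<Rightarrow> (('a \<times> 'a) \<times> ('a \<times> 'a)) set" where
  "frac_rel R S = {((a, s), (b, t)). a \<in> carrier R \<and> s \<in> S \<and> b \<in> carrier R \<and> t \<in> S \<and>
     (\<exists>u\<in>S. u \<otimes>\<^bsub>R\<^esub> (a \<otimes>\<^bsub>R\<^esub> t) = u \<otimes>\<^bsub>R\<^esub> (b \<otimes>\<^bsub>R\<^esub> s))}"

definition localization :: "('a, 'b) ring_scheme \<Rightarrow> 'a set \<Rightarrow> ('a \<times> 'a) set ring" where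
  "localization R S =
    \<lparr> carrier = (carrier R \<times> S) // frac_rel R S,
      monoid.mult = (\<lambda>A B. \<Union>(a, s)\<in>A. \<Union>(b, t)\<in>B. frac_rel R S `` {(a \<otimes>\<^bsub>R\<^esub> b, s \<otimes>\<^bsub>R\<^esub> t)}),
      one = frac_rel R S `` {(\<one>\<^bsub>R\<^esub>, \<one>\<^bsub>R\<^esub>)},
      ring.zero = frac_rel R S `` {(\<zero>\<^bsub>R\<^esub>, \<one>\<^bsub>R\<^esub>)},
      add = (\<lambda>A B. \<Union>(a, s)\<in>A. \<Union>(b, t)\<in>B.
        frac_rel R S `` {((a \<otimes>\<^bsub>R\<^esub> t) \<oplus>\<^bsub>R\<^esub> (b \<otimes>\<^bsub>R\<^esub> s), s \<otimes>\<^bsub>R\<^esub> t)}) \<rparr>"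

text \<open>\<open>R\<^sub>M\<close>; a ring for prime \<open>M\<close>, see \<open>localization_at_cring\<close> below.\<close>

definition localization_at :: "('a, 'b) ring_scheme \<Rightarrow> 'a set \<Rightarrow> ('a \<times> 'a) set ring" where
  "localization_at R M = localization R (carrier R - M)"

lemma equiv_frac_rel:
  fixes R (structure)
  assumes "cring R" "submonoid S R"
  shows "equiv (carrier R \<times> S) (frac_rel R S)"
proof -
  interpret cring R by fact
  interpret S: submonoid S R by fact
  note [simp] = S.subset[THEN subsetD]
  have "trans (frac_rel R S)"
  proof (rule transI)
    fix x y z assume xy: "(x, y) \<in> frac_rel R S" and yz: "(y, z) \<in> frac_rel R S"
    obtain a s b t c r where [simp]: "x = (a, s)" "y = (b, t)" "z = (c, r)"
      by (metis surj_pair)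
    from xy obtain u where u: "u \<in> S" "u \<otimes> (a \<otimes> t) = u \<otimes> (b \<otimes> s)"
      and c1 [simp]: "a \<in> carrier R" "s \<in> S" "b \<in> carrier R" "t \<in> S"
      by (auto simp: frac_rel_def)
    from yz obtain v where v: "v \<in> S" "v \<otimes> (b \<otimes> r) = v \<otimes> (c \<otimes> t)"
      and c2 [simp]: "c \<in> carrier R" "r \<in> S"
      by (auto simp: frac_rel_def)
    have [simp]: "u \<in> carrier R" "v \<in> carrier R" using u v by auto
    have "(u \<otimes> v \<otimes> t) \<otimes> (a \<otimes> r) = (u \<otimes> (a \<otimes> t)) \<otimes> (v \<otimes> r)"
      by (simp add: m_ac)
    also have "\<dots> = (v \<otimes> (b \<otimes> r)) \<otimes> (u \<otimes> s)"
      unfolding u(2) by (simp add: m_ac)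
    also have "\<dots> = (u \<otimes> v \<otimes> t) \<otimes> (c \<otimes> s)"
      unfolding v(2) by (simp add: m_ac)
    finally show "(x, z) \<in> frac_rel R S"
      using u(1) v(1) by (auto simp: frac_rel_def intro!: bexI[of _ "u \<otimes> v \<otimes> t"])
  qed
  moreover have "refl_on (carrier R \<times> S) (frac_rel R S)"
    using S.one_closed by (auto simp: refl_on_def frac_rel_def)
  moreover have "sym (frac_rel R S)"
    by (rule symI) (auto simp: frac_rel_def, metis)
  ultimately show ?thesis
    by (intro equivI) (auto simp: frac_rel_def)
qed

lemma localization_cring:
  fixes R :: "('a, 'b) ring_scheme" (structure)
  assumes "cring R" "submonoid S R"
  shows "cring (localization R S)"
proof -
  interpret cring R by fact
  interpret S: submonoid S R by fact
  note S [simp] = S.subset[THEN subsetD]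
  define f where "f a s = frac_rel R S `` {(a, s)}" for a s
  note eq = equiv_frac_rel[OF assms]
  have fI: "f a s = f b t" if "u \<otimes> (a \<otimes> t) = u \<otimes> (b \<otimes> s)" "u \<in> S" "a \<in> carrier R" "s \<in> S"
    "b \<in> carrier R" "t \<in> S" for a s b t u
    unfolding f_def using that by (intro equiv_class_eq[OF eq]) (auto simp: frac_rel_def)
  have fI1: "f a s = f b t" if "a \<otimes> t = b \<otimes> s" "a \<in> carrier R" "s \<in> S"
    "b \<in> carrier R" "t \<in> S" for a s b t
    using that S.one_closed by (intro fI[of \<one>]) auto
  have fE: "\<exists>u\<in>S. u \<otimes> (a \<otimes> t) = u \<otimes> (b \<otimes> s)" "b \<in> carrier R" "t \<in> S"
    if "(b, t) \<in> f a s" for a s b t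
    using that by (auto simp: f_def frac_rel_def)
  have self: "(a, s) \<in> f a s" if "a \<in> carrier R" "s \<in> S" for a s
    using that S.one_closed by (auto simp: f_def frac_rel_def)
  have ex: "\<exists>a\<in>carrier R. \<exists>s\<in>S. A = f a s" if "A \<in> carrier (localization R S)" for A
    using that by (auto simp: localization_def f_def quotient_def)
  have cl: "f a s \<in> carrier (localization R S)" if "a \<in> carrier R" "s \<in> S" for a s
    using that by (auto simp: localization_def f_def intro: quotientI)
  have UN: "(\<Union>(a', s')\<in>A. \<Union>(b', t')\<in>B. g a' s' b' t') = C"
    if g: "\<And>a' s' b' t'. (a', s') \<in> A \<Longrightarrow> (b', t') \<in> B \<Longrightarrow> g a' s' b' t' = C"
      and A: "(a, s) \<in> A" and B: "(b, t) \<in> B"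
    for A B a s b t and C :: "('a \<times> 'a) set" and g :: "'a \<Rightarrow> 'a \<Rightarrow> 'a \<Rightarrow> 'a \<Rightarrow> ('a \<times> 'a) set"
  proof -
    have "(\<Union>(a', s')\<in>A. \<Union>(b', t')\<in>B. g a' s' b' t') = (\<Union>x\<in>A. \<Union>y\<in>B. C)"
      by (intro SUP_cong refl) (auto simp: g split: prod.splits)
    also have "\<dots> = C" using A B by auto
    finally show ?thesis .
  qed
  have mult: "f a s \<otimes>\<^bsub>localization R S\<^esub> f b t = f (a \<otimes> b) (s \<otimes> t)"
    if c [simp]: "a \<in> carrier R" "s \<in> S" "b \<in> carrier R" "t \<in> S" for a s b t
  proof -
    have "f (a' \<otimes> b') (s' \<otimes> t') = f (a \<otimes> b) (s \<otimes> t)"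
      if 1: "(a', s') \<in> f a s" and 2: "(b', t') \<in> f b t" for a' s' b' t'
    proof -
      note c' [simp] = fE(2,3)[OF 1] fE(2,3)[OF 2]
      from fE(1)[OF 1] obtain u where u: "u \<in> S" "u \<otimes> (a \<otimes> s') = u \<otimes> (a' \<otimes> s)" by auto
      from fE(1)[OF 2] obtain v where v: "v \<in> S" "v \<otimes> (b \<otimes> t') = v \<otimes> (b' \<otimes> t)" by auto
      have [simp]: "u \<in> carrier R" "v \<in> carrier R" using u v by auto
      have "(u \<otimes> v) \<otimes> ((a' \<otimes> b') \<otimes> (s \<otimes> t)) = (u \<otimes> (a' \<otimes> s)) \<otimes> (v \<otimes> (b' \<otimes> t))"
        by (simp add: m_ac)
      also have "\<dots> = (u \<otimes> v) \<otimes> ((a \<otimes> b) \<otimes> (s' \<otimes> t'))"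
        unfolding u(2)[symmetric] v(2)[symmetric] by (simp add: m_ac)
      finally show ?thesis using u(1) v(1) by (intro fI[of "u \<otimes> v"]) auto
    qed
    hence "(\<Union>(a', s')\<in>f a s. \<Union>(b', t')\<in>f b t. f (a' \<otimes> b') (s' \<otimes> t')) = f (a \<otimes> b) (s \<otimes> t)"
      by (rule UN) (use self c in blast)+
    thus ?thesis by (simp add: localization_def f_def)
  qed
  have add: "f a s \<oplus>\<^bsub>localization R S\<^esub> f b t = f (a \<otimes> t \<oplus> b \<otimes> s) (s \<otimes> t)"
    if c [simp]: "a \<in> carrier R" "s \<in> S" "b \<in> carrier R" "t \<in> S" for a s b t
  proof -
    have "f (a' \<otimes> t' \<oplus> b' \<otimes> s') (s' \<otimes> t') = f (a \<otimes> t \<oplus> b \<otimes> s) (s \<otimes> t)"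
      if 1: "(a', s') \<in> f a s" and 2: "(b', t') \<in> f b t" for a' s' b' t'
    proof -
      note c' [simp] = fE(2,3)[OF 1] fE(2,3)[OF 2]
      from fE(1)[OF 1] obtain u where u: "u \<in> S" "u \<otimes> (a \<otimes> s') = u \<otimes> (a' \<otimes> s)" by auto
      from fE(1)[OF 2] obtain v where v: "v \<in> S" "v \<otimes> (b \<otimes> t') = v \<otimes> (b' \<otimes> t)" by auto
      have [simp]: "u \<in> carrier R" "v \<in> carrier R" using u v by auto
      have "(u \<otimes> v) \<otimes> ((a' \<otimes> t' \<oplus> b' \<otimes> s') \<otimes> (s \<otimes> t)) =
          (u \<otimes> (a' \<otimes> s)) \<otimes> (v \<otimes> (t \<otimes> t')) \<oplus> (v \<otimes> (b' \<otimes> t)) \<otimes> (u \<otimes> (s \<otimes> s'))"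
        by (simp add: m_ac l_distr r_distr)
      also have "\<dots> = (u \<otimes> v) \<otimes> ((a \<otimes> t \<oplus> b \<otimes> s) \<otimes> (s' \<otimes> t'))"
        unfolding u(2)[symmetric] v(2)[symmetric] by (simp add: m_ac l_distr r_distr)
      finally show ?thesis using u(1) v(1) by (intro fI[of "u \<otimes> v"]) auto
    qed
    hence "(\<Union>(a', s')\<in>f a s. \<Union>(b', t')\<in>f b t. f (a' \<otimes> t' \<oplus> b' \<otimes> s') (s' \<otimes> t')) =
        f (a \<otimes> t \<oplus> b \<otimes> s) (s \<otimes> t)"
      by (rule UN) (use self c in blast)+
    thus ?thesis by (simp add: localization_def f_def)
  qed
  have one: "\<one>\<^bsub>localization R S\<^esub> = f \<one> \<one>" and zero: "\<zero>\<^bsub>localization R S\<^esub> = f \<zero> \<one>"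
    by (auto simp: localization_def f_def)
  note [simp] = S.one_closed add mult one zero cl
  show ?thesis
  proof (intro cringI abelian_groupI comm_monoidI)
    fix A assume "A \<in> carrier (localization R S)"
    then obtain a s where [simp]: "A = f a s" "a \<in> carrier R" "s \<in> S" using ex by blast
    show "\<zero>\<^bsub>localization R S\<^esub> \<oplus>\<^bsub>localization R S\<^esub> A = A"
      by (auto intro!: fI1)
    show "\<one>\<^bsub>localization R S\<^esub> \<otimes>\<^bsub>localization R S\<^esub> A = A"
      by simp
    have "f (\<ominus> a) s \<oplus>\<^bsub>localization R S\<^esub> A = \<zero>\<^bsub>localization R S\<^esub>"
      by (simp add: l_minus l_neg, rule fI1) simp_all
    thus "\<exists>B\<in>carrier (localization R S). B \<oplus>\<^bsub>localization R S\<^esub> A = \<zero>\<^bsub>localization R S\<^esub>"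
      by (intro bexI[of _ "f (\<ominus> a) s"]) auto
    fix B assume "B \<in> carrier (localization R S)"
    then obtain b t where [simp]: "B = f b t" "b \<in> carrier R" "t \<in> S" using ex by blast
    show "A \<oplus>\<^bsub>localization R S\<^esub> B \<in> carrier (localization R S)"
      "A \<otimes>\<^bsub>localization R S\<^esub> B \<in> carrier (localization R S)"
      by auto
    show "A \<oplus>\<^bsub>localization R S\<^esub> B = B \<oplus>\<^bsub>localization R S\<^esub> A"
      "A \<otimes>\<^bsub>localization R S\<^esub> B = B \<otimes>\<^bsub>localization R S\<^esub> A"
      by (simp_all add: m_comm a_comm)
    fix C assume "C \<in> carrier (localization R S)"
    then obtain c r where [simp]: "C = f c r" "c \<in> carrier R" "r \<in> S" using ex by blast
    show "A \<oplus>\<^bsub>localization R S\<^esub> B \<oplus>\<^bsub>localization R S\<^esub> C =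
        A \<oplus>\<^bsub>localization R S\<^esub> (B \<oplus>\<^bsub>localization R S\<^esub> C)"
      by (simp add: m_ac l_distr r_distr a_ac)
    show "A \<otimes>\<^bsub>localization R S\<^esub> B \<otimes>\<^bsub>localization R S\<^esub> C =
        A \<otimes>\<^bsub>localization R S\<^esub> (B \<otimes>\<^bsub>localization R S\<^esub> C)"
      by (simp add: m_assoc)
    show "(A \<oplus>\<^bsub>localization R S\<^esub> B) \<otimes>\<^bsub>localization R S\<^esub> C =
        A \<otimes>\<^bsub>localization R S\<^esub> C \<oplus>\<^bsub>localization R S\<^esub> B \<otimes>\<^bsub>localization R S\<^esub> C"
      by simp (rule fI1, simp_all add: m_ac l_distr r_distr)
  qed auto
qed

lemma localization_at_cring:
  fixes R (structure)
  assumes "primeideal M R"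
  shows "cring (localization_at R M)"
proof -
  interpret primeideal M R by fact
  have "submonoid (carrier R - M) R"
    using I_prime one_imp_carrier I_notcarr by unfold_locales auto
  thus ?thesis
    unfolding localization_at_def by (rule localization_cring[OF is_cring])
qed


section \<open>Chained and arithmetical rings\<close>

definition chained_ring :: "('a, 'b) ring_scheme \<Rightarrow> bool" where
  "chained_ring R \<longleftrightarrow> (\<forall>I J. ideal I R \<longrightarrow> ideal J R \<longrightarrow> I \<subseteq> J \<or> J \<subseteq> I)"

definition arithmetical_ring :: "('a, 'b) ring_scheme \<Rightarrow> bool" where
  "arithmetical_ring R \<longleftrightarrow> (\<forall>M. maximalideal M R \<longrightarrow> chained_ring (localization_at R M))"


section \<open>Factorizations of ideals\<close>

definition proper_ideal :: "'a set \<Rightarrow> ('a, 'b) ring_scheme \<Rightarrow> bool" where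
  "proper_ideal I R \<longleftrightarrow> ideal I R \<and> I \<noteq> carrier R"

definition OA_ideal :: "'a set \<Rightarrow> ('a, 'b) ring_scheme \<Rightarrow> bool" where
  "OA_ideal I R \<longleftrightarrow> proper_ideal I R \<and>
    (\<forall>a \<in> carrier R - Units R. \<forall>b \<in> carrier R - Units R. \<forall>c \<in> carrier R - Units R.
      a \<otimes>\<^bsub>R\<^esub> b \<otimes>\<^bsub>R\<^esub> c \<in> I \<longrightarrow> a \<otimes>\<^bsub>R\<^esub> b \<in> I \<or> c \<in> I)"

text \<open>Products of ideals are taken in the commutative monoid \<^term>\<open>ideals_set R\<close>, whose
  multiplication is \<^term>\<open>ideal_prod R\<close>.\<close>

definition has_OA_factorization :: "('a, 'b) ring_scheme \<Rightarrow> 'a set \<Rightarrow> bool" where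
  "has_OA_factorization R I \<longleftrightarrow>
    (\<exists>(n::nat) J. n \<ge> 1 \<and> (\<forall>i\<in>{1..n}. OA_ideal (J i) R) \<and>
      I = (\<Otimes>\<^bsub>ideals_set R\<^esub> i\<in>{1..n}. J i))"

definition OAF_ring :: "('a, 'b) ring_scheme \<Rightarrow> bool" where
  "OAF_ring R \<longleftrightarrow> (\<forall>I. proper_ideal I R \<longrightarrow> has_OA_factorization R I)"

definition general_ZPI_ring :: "('a, 'b) ring_scheme \<Rightarrow> bool" where
  "general_ZPI_ring R \<longleftrightarrow> (\<forall>I. proper_ideal I R \<longrightarrow>
    (\<exists>(n::nat) P. n \<ge> 1 \<and> (\<forall>i\<in>{1..n}. primeideal (P i) R) \<and>
      I = (\<Otimes>\<^bsub>ideals_set R\<^esub> i\<in>{1..n}. P i)))"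

end

theory Submission
  imports Defs
begin

text \<open>Everything is checked locally, with \<open>R\<^sub>M\<close> replaced by saturations: \<open>I\<close> and \<open>J\<close> have the same
  extension to \<open>R\<^sub>M\<close> iff \<open>sat M I = sat M J\<close>, where \<open>sat M I\<close> consists of the \<open>x\<close> with \<open>s x \<in> I\<close> for
  some \<open>s \<notin> M\<close>. The pivot is the condition that every principal ideal is, locally at each maximal ideal \<open>M\<close>,
  zero or a power of \<open>M\<close>. It follows once every \<open>M\<close> is locally principal and principal ideals are
  products of primes, and it makes \<open>R\<close> arithmetical.

  In a general ZPI-ring, let \<open>Q\<close> be prime. If \<open>x \<in> Q\<close> lies outside \<open>Q\<^sup>2\<close> locally, then \<open>(x) + (z\<^sup>2)\<close> is
  locally prime for each \<open>z \<in> Q\<close>, hence contains \<open>z\<close>, and \<open>Q\<close> is locally generated by \<open>x\<close>. If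
  \<open>Q = Q\<^sup>2\<close> locally, then \<open>Q\<close> is a minimal prime, hence locally zero because the zero ideal is locally a power of \<open>Q\<close>.

  Conversely, in an arithmetical ring every OA-ideal is a prime or the square of a maximal ideal, so
  principal ideals are products of primes, and chained localizations make each \<open>M\<close> locally principal.
  Then at most two primes lie below each \<open>M\<close>, an ideal \<open>I\<close> has finitely many minimal primes, and \<open>I\<close>
  agrees locally with a product of powers of them.\<close>

section \<open>Products of ideals, saturation and elementary ideal arithmetic\<close>

no_notation Sum_Type.Plus (infixr \<open><+>\<close> 65)

text \<open>Rule induction on this set replaces reasoning with indexed products. The empty product
  is included, so for a set \<open>X\<close> of ideals this is the submonoid of
  \<open>ideals_set R\<close> generated by \<open>X\<close>.\<close>

inductive_set ideal_products :: "('a, 'b) ring_scheme \<Rightarrow> 'a set set \<Rightarrow> 'a set set"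
  for R (structure) and X where
  one: "carrier R \<in> ideal_products R X"
| mult: "\<lbrakk>J \<in> X; I \<in> ideal_products R X\<rbrakk> \<Longrightarrow> J \<cdot> I \<in> ideal_products R X"

abbreviation prime_products :: "('a, 'b) ring_scheme \<Rightarrow> 'a set set" where
  "prime_products R \<equiv> ideal_products R {P. primeideal P R}"

definition saturation :: "('a, 'b) ring_scheme \<Rightarrow> 'a set \<Rightarrow> 'a set \<Rightarrow> 'a set" (\<open>sat\<index>\<close>) where
  "sat\<^bsub>R\<^esub> Q I = {x \<in> carrier R. \<exists>s\<in>carrier R - Q. s \<otimes>\<^bsub>R\<^esub> x \<in> I}"

context cring
begin

lemma ideal_intro:
  assumes "I \<subseteq> carrier R" "\<zero> \<in> I" "\<And>x y. x \<in> I \<Longrightarrow> y \<in> I \<Longrightarrow> x \<oplus> y \<in> I"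
    "\<And>x r. x \<in> I \<Longrightarrow> r \<in> carrier R \<Longrightarrow> r \<otimes> x \<in> I"
  shows "ideal I R"
proof (rule idealI)
  show "subgroup I (add_monoid R)"
  proof (rule add.subgroupI)
    fix x assume x: "x \<in> I"
    then have "(\<ominus> \<one>) \<otimes> x \<in> I" using assms(4) by blast
    then show "\<ominus> x \<in> I" using x assms(1) by (auto simp: l_minus subset_eq)
  qed (use assms in auto)
  show "x \<in> I \<Longrightarrow> r \<in> carrier R \<Longrightarrow> x \<otimes> r \<in> I" for x r
    using assms(1,4) m_comm[of x r] by auto
qed (use assms in \<open>auto simp: ring_axioms\<close>)

lemma ideal_subset: "ideal I R \<Longrightarrow> I \<subseteq> carrier R"
  by (auto dest: ideal.Icarr)

lemma ideal_zero: "ideal I R \<Longrightarrow> \<zero> \<in> I"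
  by (simp add: additive_subgroup.zero_closed ideal.axioms(1))

lemma ideal_add: "ideal I R \<Longrightarrow> x \<in> I \<Longrightarrow> y \<in> I \<Longrightarrow> x \<oplus> y \<in> I"
  by (simp add: additive_subgroup.a_closed ideal.axioms(1))

lemma ideal_minus: "ideal I R \<Longrightarrow> x \<in> I \<Longrightarrow> y \<in> I \<Longrightarrow> x \<ominus> y \<in> I"
  by (simp add: a_minus_def additive_subgroup.a_closed additive_subgroup.a_inv_closed ideal.axioms(1))

lemma ideal_mult: "ideal I R \<Longrightarrow> x \<in> I \<Longrightarrow> r \<in> carrier R \<Longrightarrow> r \<otimes> x \<in> I"
  by (simp add: ideal.I_l_closed)

lemma ideal_mult_r: "ideal I R \<Longrightarrow> x \<in> I \<Longrightarrow> r \<in> carrier R \<Longrightarrow> x \<otimes> r \<in> I"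
  by (simp add: ideal.I_r_closed)

lemma ideal_cancel_add:
  assumes "ideal I R" "x \<oplus> y \<in> I" "y \<in> I" "x \<in> carrier R"
  shows "x \<in> I"
proof -
  have "y \<in> carrier R" using assms by (auto dest: ideal.Icarr)
  then have "x = (x \<oplus> y) \<ominus> y" using assms by algebra
  then show ?thesis using ideal_minus[OF assms(1-3)] by simp
qed

lemma ideal_prod_least:
  assumes "ideal K R" "\<And>i j. i \<in> I \<Longrightarrow> j \<in> J \<Longrightarrow> i \<otimes> j \<in> K"
  shows "I \<cdot> J \<subseteq> K"
proof
  fix x assume "x \<in> I \<cdot> J"
  then show "x \<in> K" by induction (use assms ideal_add in auto)
qed

lemma ideal_prod_mono: "I \<subseteq> I' \<Longrightarrow> J \<subseteq> J' \<Longrightarrow> I \<cdot> J \<subseteq> I' \<cdot> J'"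
proof
  fix x assume *: "I \<subseteq> I'" "J \<subseteq> J'" "x \<in> I \<cdot> J"
  from *(3) show "x \<in> I' \<cdot> J'" by induction (use * in \<open>auto intro: ideal_prod.intros\<close>)
qed

lemma ideal_add_iff: "x \<in> I <+> J \<longleftrightarrow> (\<exists>i\<in>I. \<exists>j\<in>J. x = i \<oplus> j)"
  by (auto simp: set_add_def')

lemma ideal_add_supset:
  assumes "ideal I R" "ideal J R" shows "I \<subseteq> I <+> J" "J \<subseteq> I <+> J"
proof -
  show "I \<subseteq> I <+> J"
    using assms ideal_zero by (force simp: ideal_add_iff dest: ideal.Icarr)
  show "J \<subseteq> I <+> J"
    using assms ideal_zero by (force simp: ideal_add_iff dest: ideal.Icarr)
qed

lemma ideal_add_least: "ideal K R \<Longrightarrow> I \<subseteq> K \<Longrightarrow> J \<subseteq> K \<Longrightarrow> I <+> J \<subseteq> K"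
  by (force simp: ideal_add_iff intro: ideal_add)

lemma PIdl_iff: "x \<in> PIdl a \<longleftrightarrow> (\<exists>r\<in>carrier R. x = r \<otimes> a)"
  by (auto simp: cgenideal_def)

lemma primeideal_ideal: "primeideal P R \<Longrightarrow> ideal P R"
  by (simp add: primeideal.axioms(1))

lemma primeideal_mult_notin:
  "primeideal P R \<Longrightarrow> a \<in> carrier R - P \<Longrightarrow> b \<in> carrier R - P \<Longrightarrow> a \<otimes> b \<in> carrier R - P"
  using primeideal.I_prime by fastforce

lemma primeideal_one_notin: "primeideal P R \<Longrightarrow> \<one> \<in> carrier R - P"
  using ideal.one_imp_carrier primeideal.I_notcarr primeideal_ideal by blast

lemma primeideal_minus_notin:
  assumes "ideal Q R" "s \<in> carrier R - Q" "q \<in> Q" shows "s \<ominus> q \<in> carrier R - Q"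
proof -
  have c: "q \<in> carrier R" "s \<in> carrier R" using assms by (auto dest: ideal.Icarr)
  then have "s = (s \<ominus> q) \<oplus> q" by algebra
  then show ?thesis using assms ideal_add[OF assms(1) _ assms(3)] c by fastforce
qed

lemma exists_maximalideal:
  assumes "ideal I R" "I \<noteq> carrier R"
  obtains M where "maximalideal M R" "I \<subseteq> M"
proof -
  \<comment> \<open>Properness is encoded as \<open>\<one> \<notin> J\<close>, which passes to
    unions of chains.\<close>
  let ?A = "{J. ideal J R \<and> I \<subseteq> J \<and> \<one> \<notin> J}"
  have "\<exists>M\<in>?A. \<forall>X\<in>?A. M \<subseteq> X \<longrightarrow> X = M"
  proof (rule subset_Zorn_nonempty)
    show "?A \<noteq> {}" using assms ideal.one_imp_carrier by blast
    fix C assume C: "C \<noteq> {}" "subset.chain ?A C"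
    then have sub: "C \<subseteq> ?A" and ch: "\<And>x y. x \<in> C \<Longrightarrow> y \<in> C \<Longrightarrow> x \<subseteq> y \<or> y \<subseteq> x"
      by (auto simp: subset.chain_def)
    have "ideal (\<Union>C) R"
    proof (rule ideal_intro)
      show "\<Union>C \<subseteq> carrier R" "\<zero> \<in> \<Union>C" using C(1) sub ideal_subset ideal_zero by blast+
      show "r \<otimes> x \<in> \<Union>C" if "x \<in> \<Union>C" "r \<in> carrier R" for x r
        using that sub ideal_mult by blast
      show "x \<oplus> y \<in> \<Union>C" if xy: "x \<in> \<Union>C" "y \<in> \<Union>C" for x y
      proof -
        obtain A B where "A \<in> C" "B \<in> C" "x \<in> A" "y \<in> B" using xy by blast
        then have "(x \<in> A \<and> y \<in> A) \<or> (x \<in> B \<and> y \<in> B)" using ch[of A B] by blast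
        then show ?thesis using sub ideal_add \<open>A \<in> C\<close> \<open>B \<in> C\<close> by blast
      qed
    qed
    then show "\<Union>C \<in> ?A" using C(1) sub by auto
  qed
  then obtain M where M: "ideal M R" "I \<subseteq> M" "\<one> \<notin> M"
    and max: "\<And>X. ideal X R \<Longrightarrow> I \<subseteq> X \<Longrightarrow> \<one> \<notin> X \<Longrightarrow> M \<subseteq> X \<Longrightarrow> X = M"
    by auto
  have "maximalideal M R"
  proof (rule maximalidealI)
    show "carrier R \<noteq> M" using M(3) by auto
    fix J assume "ideal J R" "M \<subseteq> J" "J \<subseteq> carrier R"
    then show "J = M \<or> J = carrier R" using max[of J] M(2) ideal.one_imp_carrier by blast
  qed (rule M)
  then show thesis using M that by blast
qed

lemma maximal_eq:
  assumes "maximalideal M R" "primeideal P R" "M \<subseteq> P" shows "P = M"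
  using maximalideal.I_maximal[OF assms(1) primeideal_ideal[OF assms(2)] assms(3)]
    ideal_subset[OF primeideal_ideal[OF assms(2)]] primeideal.I_notcarr[OF assms(2)] by blast

section \<open>Saturation\<close>

lemma sat_iff: "x \<in> sat Q I \<longleftrightarrow> x \<in> carrier R \<and> (\<exists>s\<in>carrier R - Q. s \<otimes> x \<in> I)"
  by (simp add: saturation_def)

lemma satI: "s \<otimes> x \<in> I \<Longrightarrow> s \<in> carrier R - Q \<Longrightarrow> x \<in> carrier R \<Longrightarrow> x \<in> sat Q I"
  unfolding sat_iff by blast

lemma sat_mono: "I \<subseteq> J \<Longrightarrow> sat Q I \<subseteq> sat Q J"
  unfolding sat_iff subset_iff by blast

context
  fixes Q assumes Q: "primeideal Q R"
begin

lemma sat_supset: assumes "ideal I R" shows "I \<subseteq> sat Q I"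
  using primeideal_one_notin[OF Q] ideal.Icarr[OF assms]
  by (auto intro!: satI[of \<one>])

lemma sat_ideal: assumes I: "ideal I R" shows "ideal (sat Q I) R"
proof (rule ideal_intro)
  show "sat Q I \<subseteq> carrier R" by (auto simp: sat_iff)
  show "\<zero> \<in> sat Q I" using sat_supset I ideal_zero by blast
next
  fix x y assume "x \<in> sat Q I" "y \<in> sat Q I"
  then obtain s t where st: "s \<in> carrier R - Q" "t \<in> carrier R - Q" "s \<otimes> x \<in> I" "t \<otimes> y \<in> I"
    and c: "x \<in> carrier R" "y \<in> carrier R" "s \<in> carrier R" "t \<in> carrier R"
    by (auto simp: sat_iff)
  have "(s \<otimes> t) \<otimes> (x \<oplus> y) = t \<otimes> (s \<otimes> x) \<oplus> s \<otimes> (t \<otimes> y)"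
    using st c by algebra
  also have "\<dots> \<in> I" using st I by (auto intro: ideal_add ideal_mult)
  finally show "x \<oplus> y \<in> sat Q I" using satI primeideal_mult_notin[OF Q] st c by blast
next
  fix x r assume "x \<in> sat Q I" and r: "r \<in> carrier R"
  then obtain s where s: "s \<in> carrier R - Q" "s \<otimes> x \<in> I" and c: "x \<in> carrier R" "s \<in> carrier R"
    by (auto simp: sat_iff)
  have "s \<otimes> (r \<otimes> x) = r \<otimes> (s \<otimes> x)" using s c r by algebra
  then show "r \<otimes> x \<in> sat Q I" using s c r I ideal_mult satI[of s "r \<otimes> x"] by auto
qed

lemma sat_sat [simp]: assumes "ideal I R" shows "sat Q (sat Q I) = sat Q I"
proof
  show "sat Q (sat Q I) \<subseteq> sat Q I"
  proof
    fix x assume "x \<in> sat Q (sat Q I)"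
    then obtain s t where "s \<in> carrier R - Q" "t \<in> carrier R - Q" "t \<otimes> (s \<otimes> x) \<in> I" "x \<in> carrier R"
      by (auto simp: sat_iff)
    then show "x \<in> sat Q I"
      using primeideal_mult_notin[OF Q, of t s] by (intro satI[of "t \<otimes> s"]) (auto simp: m_assoc)
  qed
qed (rule sat_supset[OF sat_ideal[OF assms]])

lemma sat_subset: "ideal J R \<Longrightarrow> I \<subseteq> sat Q J \<Longrightarrow> sat Q I \<subseteq> sat Q J"
  using sat_mono[of I "sat Q J" Q] by simp

lemma sat_eqI: "ideal I R \<Longrightarrow> ideal J R \<Longrightarrow> I \<subseteq> sat Q J \<Longrightarrow> J \<subseteq> sat Q I \<Longrightarrow> sat Q I = sat Q J"
  using sat_subset by blast

lemma sat_prime: assumes "primeideal P R" "P \<subseteq> Q" shows "sat Q P = P"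
proof
  show "sat Q P \<subseteq> P"
  proof
    fix x assume "x \<in> sat Q P"
    then obtain s where "s \<in> carrier R" "s \<notin> Q" "s \<otimes> x \<in> P" "x \<in> carrier R"
      by (auto simp: sat_iff)
    then show "x \<in> P" using primeideal.I_prime[OF assms(1), of s x] assms(2) by auto
  qed
qed (rule sat_supset[OF primeideal_ideal[OF assms(1)]])

lemma sat_eq_carrier:
  assumes "ideal I R" "\<not> I \<subseteq> Q" shows "sat Q I = carrier R"
proof
  obtain s where "s \<in> I" "s \<notin> Q" using assms by blast
  then show "carrier R \<subseteq> sat Q I"
    using ideal_mult_r[OF assms(1)] ideal.Icarr[OF assms(1)] by (auto intro!: satI[of s])
qed (auto simp: sat_iff)

lemma sat_prod_subset:
  assumes I: "ideal I R" and J: "ideal J R" shows "sat Q I \<cdot> sat Q J \<subseteq> sat Q (I \<cdot> J)"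
proof (rule ideal_prod_least)
  show "ideal (sat Q (I \<cdot> J)) R" by (intro sat_ideal ideal_prod_is_ideal I J)
  fix i j assume "i \<in> sat Q I" "j \<in> sat Q J"
  then obtain s t where st: "s \<in> carrier R - Q" "t \<in> carrier R - Q" "s \<otimes> i \<in> I" "t \<otimes> j \<in> J"
    and c: "i \<in> carrier R" "j \<in> carrier R" "s \<in> carrier R" "t \<in> carrier R"
    by (auto simp: sat_iff)
  have "(s \<otimes> t) \<otimes> (i \<otimes> j) = (s \<otimes> i) \<otimes> (t \<otimes> j)" using st c by algebra
  also have "\<dots> \<in> I \<cdot> J" using st by (auto intro: ideal_prod.prod)
  finally show "i \<otimes> j \<in> sat Q (I \<cdot> J)" using satI primeideal_mult_notin[OF Q] st c by blast
qed

lemma sat_prod_mono: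
  assumes "ideal I R" "ideal J R" "ideal I' R" "ideal J' R" "I \<subseteq> sat Q I'" "J \<subseteq> sat Q J'"
  shows "I \<cdot> J \<subseteq> sat Q (I' \<cdot> J')"
  using ideal_prod_mono[OF assms(5,6)] sat_prod_subset assms by blast

lemma sat_prod_cong:
  assumes "ideal I R" "ideal J R" "ideal I' R" "ideal J' R" "sat Q I = sat Q I'" "sat Q J = sat Q J'"
  shows "sat Q (I \<cdot> J) = sat Q (I' \<cdot> J')"
  using assms sat_supset
  by (intro sat_eqI ideal_prod_is_ideal sat_prod_mono) auto

lemma sat_prod_drop:
  assumes "ideal I R" "ideal J R" "\<not> J \<subseteq> Q" shows "sat Q (I \<cdot> J) = sat Q I"
  using sat_prod_cong[OF assms(1,2,1) oneideal refl] sat_eq_carrier[OF assms(2,3)]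
    sat_supset[OF oneideal] ideal_prod_one[OF assms(1)]
  by (metis assms(2) ideal_subset oneideal sat_ideal subset_antisym)

text \<open>Nakayama's lemma for one element: \<open>s \<ominus> q\<close> stays outside
  \<open>Q\<close>, hence is a denominator of the localization, and it multiplies \<open>a\<close>
  into \<open>K\<close>.\<close>

lemma sat_nakayama:
  assumes K: "ideal K R" and "a \<in> carrier R" "s \<in> carrier R - Q" "q \<in> Q" "s \<otimes> a \<ominus> q \<otimes> a \<in> K"
  shows "a \<in> sat Q K"
proof (rule satI)
  have "q \<in> carrier R" "s \<in> carrier R"
    using assms ideal.Icarr[OF primeideal_ideal[OF Q]] by auto
  then have "(s \<ominus> q) \<otimes> a = s \<otimes> a \<ominus> q \<otimes> a" using assms by algebra
  then show "(s \<ominus> q) \<otimes> a \<in> K" using assms by simp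
qed (use primeideal_minus_notin[OF primeideal_ideal[OF Q]] assms in auto)

end

text \<open>The local-global principle. For \<open>x\<close> in \<open>I\<close>, the ideal of all
  \<open>r\<close> with \<open>r \<otimes> x \<in> J\<close> lies in no maximal ideal
  \<open>M\<close>, because \<open>x \<in> sat M J\<close> supplies such an \<open>r\<close> outside
  \<open>M\<close>.\<close>

lemma subset_if_sat_subset:
  assumes I: "ideal I R" and J: "ideal J R" and le: "\<And>M. maximalideal M R \<Longrightarrow> I \<subseteq> sat M J"
  shows "I \<subseteq> J"
proof
  fix x assume x: "x \<in> I"
  then have xc: "x \<in> carrier R" using I by (rule ideal.Icarr[rotated])
  let ?K = "{r \<in> carrier R. r \<otimes> x \<in> J}"
  have K: "ideal ?K R"
  proof (rule ideal_intro)
    show "\<zero> \<in> ?K" using xc ideal_zero[OF J] by simp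
  qed (use xc J in \<open>auto simp: l_distr m_assoc intro: ideal_add ideal_mult\<close>)
  have "?K = carrier R"
  proof (rule ccontr)
    assume "?K \<noteq> carrier R"
    then obtain M where M: "maximalideal M R" "?K \<subseteq> M" using exists_maximalideal[OF K] by blast
    obtain s where "s \<in> carrier R - M" "s \<otimes> x \<in> J"
      using subsetD[OF le[OF M(1)] x] unfolding sat_iff by blast
    then show False using M(2) by blast
  qed
  then show "x \<in> J" using one_closed xc by (metis (mono_tags, lifting) l_one mem_Collect_eq)
qed

section \<open>Products of ideals\<close>

lemma ideals_set_simps:
  "carrier (ideals_set R) = {I. ideal I R}" "\<one>\<^bsub>ideals_set R\<^esub> = carrier R"
  "I \<otimes>\<^bsub>ideals_set R\<^esub> J = I \<cdot> J"
  by (simp_all add: ideals_set_def)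

lemma ideal_power_0: "I [^]\<^bsub>ideals_set R\<^esub> (0::nat) = carrier R"
  by (simp add: ideals_set_simps)

lemma ideal_power_Suc: "I [^]\<^bsub>ideals_set R\<^esub> Suc n = (I [^]\<^bsub>ideals_set R\<^esub> n) \<cdot> I"
  by (simp add: ideals_set_simps)

lemma ideal_power_ideal: "ideal I R \<Longrightarrow> ideal (I [^]\<^bsub>ideals_set R\<^esub> (n::nat)) R"
  by (induction n) (simp_all add: ideals_set_simps oneideal ideal_prod_is_ideal)

lemma ideal_power_decreasing:
  assumes "ideal I R" "m \<le> n"
  shows "I [^]\<^bsub>ideals_set R\<^esub> (n::nat) \<subseteq> I [^]\<^bsub>ideals_set R\<^esub> m"
  using assms(2)
proof (induction rule: dec_induct)
  case (step k)
  then show ?case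
    using ideal_prod_inter[OF ideal_power_ideal[OF assms(1)] assms(1), of k]
    unfolding ideal_power_Suc by blast
qed simp

lemma prime_of_ideal_power_subset:
  assumes "primeideal P R" "ideal I R" "I [^]\<^bsub>ideals_set R\<^esub> (n::nat) \<subseteq> P"
  shows "I \<subseteq> P"
  using assms(3)
proof (induction n)
  case 0
  then show ?case using primeideal_one_notin[OF assms(1)] by (auto simp: ideals_set_simps)
next
  case (Suc n)
  then show ?case
    using primeideal_divides_ideal_prod[OF assms(1) ideal_power_ideal[OF assms(2)] assms(2), of n]
    unfolding ideal_power_Suc by blast
qed

lemma ideal_products_ideal:
  assumes "\<And>J. J \<in> X \<Longrightarrow> ideal J R" "I \<in> ideal_products R X" shows "ideal I R"
  using assms(2) by induction (auto intro: oneideal ideal_prod_is_ideal assms(1))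

lemma ideal_products_mult:
  assumes X: "\<And>J. J \<in> X \<Longrightarrow> ideal J R"
    and "I \<in> ideal_products R X" "J \<in> ideal_products R X"
  shows "I \<cdot> J \<in> ideal_products R X"
  using assms(2)
proof induction
  case one
  have "carrier R \<cdot> J = J"
    using ideal_prod_one ideal_prod_commute oneideal ideal_products_ideal[OF X assms(3)] by metis
  then show ?case using assms(3) by simp
next
  case (mult K I)
  then show ?case
    using ideal_products_ideal[OF X] X assms(3) by (auto simp: ideal_prod_assoc intro: ideal_products.mult)
qed

lemma ideal_products_trans:
  assumes "\<And>J. J \<in> Y \<Longrightarrow> ideal J R" "X \<subseteq> ideal_products R Y" "I \<in> ideal_products R X"
  shows "I \<in> ideal_products R Y"
  using assms(3)
  by induction (use assms(1,2) in \<open>auto intro: ideal_products.one ideal_products_mult\<close>)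

lemma ideal_in_products: "ideal I R \<Longrightarrow> I \<in> X \<Longrightarrow> I \<in> ideal_products R X"
  using ideal_products.mult[OF _ ideal_products.one, of I X R] by (simp add: ideal_prod_one)

lemma ideal_products_iff_finprod:
  assumes X: "\<And>J. J \<in> X \<Longrightarrow> ideal J R"
  shows "I \<in> ideal_products R X \<longleftrightarrow>
    (\<exists>(n::nat) J. (\<forall>i\<in>{1..n}. J i \<in> X) \<and> I = (\<Otimes>\<^bsub>ideals_set R\<^esub> i\<in>{1..n}. J i))"
proof
  interpret ISet: comm_monoid "ideals_set R" by (rule ideals_set_is_comm_monoid)
  have step: "(\<Otimes>\<^bsub>ideals_set R\<^esub> i\<in>{1..Suc n}. J i) = J (Suc n) \<cdot> (\<Otimes>\<^bsub>ideals_set R\<^esub> i\<in>{1..n}. J i)"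
    if "\<forall>i\<in>{1..Suc n}. J i \<in> X" for J and n :: nat
  proof -
    have "J \<in> {1..n} \<rightarrow> carrier (ideals_set R)" "J (Suc n) \<in> carrier (ideals_set R)"
      using that X by (auto simp: ideals_set_simps)
    then show ?thesis
      using ISet.finprod_insert[of "{1..n}" "Suc n" J]
      by (simp add: atLeastAtMostSuc_conv ideals_set_simps)
  qed
  show "\<exists>(n::nat) J. (\<forall>i\<in>{1..n}. J i \<in> X) \<and> I = (\<Otimes>\<^bsub>ideals_set R\<^esub> i\<in>{1..n}. J i)"
    if "I \<in> ideal_products R X"
    using that
  proof induction
    case one
    show ?case by (intro exI[of _ 0]) (simp add: ideals_set_simps)
  next
    case (mult K I)
    then obtain n J where J: "\<forall>i\<in>{1..n::nat}. J i \<in> X" "I = (\<Otimes>\<^bsub>ideals_set R\<^esub> i\<in>{1..n}. J i)"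
      by blast
    \<comment> \<open>The new factor is placed just past the old indices, so the old product is
      unchanged.\<close>
    let ?J = "J(Suc n := K)"
    have JX: "\<forall>i\<in>{1..Suc n}. ?J i \<in> X" using J mult.hyps by (auto simp: le_Suc_eq)
    have "(\<Otimes>\<^bsub>ideals_set R\<^esub> i\<in>{1..n}. ?J i) = (\<Otimes>\<^bsub>ideals_set R\<^esub> i\<in>{1..n}. J i)"
      using J X by (intro ISet.finprod_cong') (auto simp: ideals_set_simps)
    then have "K \<cdot> I = (\<Otimes>\<^bsub>ideals_set R\<^esub> i\<in>{1..Suc n}. ?J i)"
      using step[OF JX] J(2) by simp
    then show ?case using JX by blast
  qed
  show "I \<in> ideal_products R X"
    if "\<exists>(n::nat) J. (\<forall>i\<in>{1..n}. J i \<in> X) \<and> I = (\<Otimes>\<^bsub>ideals_set R\<^esub> i\<in>{1..n}. J i)"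
  proof -
    have "(\<Otimes>\<^bsub>ideals_set R\<^esub> i\<in>{1..n}. J i) \<in> ideal_products R X"
      if "\<forall>i\<in>{1..n}. J i \<in> X" for J and n :: nat
      using that
    proof (induction n)
      case 0
      show ?case by (simp add: ideals_set_simps ideal_products.one)
    next
      case (Suc n)
      then show ?case unfolding step[OF Suc.prems] by (intro ideal_products.mult) auto
    qed
    then show ?thesis using that by blast
  qed
qed

text \<open>The definitions demand \<open>n \<ge> 1\<close> while the inductive set admits the empty
  product. These agree on proper ideals, as the empty product is the whole ring.\<close>

lemma proper_ideal_products_iff_finprod:
  assumes X: "\<And>J. J \<in> X \<Longrightarrow> ideal J R" and I: "proper_ideal I R"
  shows "(\<exists>(n::nat) J. n \<ge> 1 \<and> (\<forall>i\<in>{1..n}. J i \<in> X) \<and> I = (\<Otimes>\<^bsub>ideals_set R\<^esub> i\<in>{1..n}. J i)) \<longleftrightarrow>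
    I \<in> ideal_products R X"
proof
  assume "I \<in> ideal_products R X"
  then obtain n J where J: "\<forall>i\<in>{1..n::nat}. J i \<in> X" "I = (\<Otimes>\<^bsub>ideals_set R\<^esub> i\<in>{1..n}. J i)"
    using ideal_products_iff_finprod[OF X] by blast
  interpret ISet: comm_monoid "ideals_set R" by (rule ideals_set_is_comm_monoid)
  have "n \<noteq> 0"
    using J(2) I by (auto simp: proper_ideal_def ideals_set_simps)
  then show "\<exists>(n::nat) J. n \<ge> 1 \<and> (\<forall>i\<in>{1..n}. J i \<in> X) \<and> I = (\<Otimes>\<^bsub>ideals_set R\<^esub> i\<in>{1..n}. J i)"
    using J by (intro exI[of _ n] exI[of _ J]) auto
qed (use ideal_products_iff_finprod[OF X] in blast)

lemma has_OA_factorization_iff: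
  "proper_ideal I R \<Longrightarrow> has_OA_factorization R I \<longleftrightarrow> I \<in> ideal_products R {J. OA_ideal J R}"
  using proper_ideal_products_iff_finprod[of "{J. OA_ideal J R}" I]
  by (simp add: has_OA_factorization_def OA_ideal_def proper_ideal_def)

lemma prime_products_ideal: "I \<in> prime_products R \<Longrightarrow> ideal I R"
  by (rule ideal_products_ideal) (auto intro: primeideal_ideal)

lemma prime_in_prime_products: "primeideal P R \<Longrightarrow> P \<in> prime_products R"
  by (auto intro: ideal_in_products primeideal_ideal)

lemma prime_products_mult:
  "I \<in> prime_products R \<Longrightarrow> J \<in> prime_products R \<Longrightarrow> I \<cdot> J \<in> prime_products R"
  by (rule ideal_products_mult) (auto intro: primeideal_ideal)

lemma prime_products_power:
  "I \<in> prime_products R \<Longrightarrow> I [^]\<^bsub>ideals_set R\<^esub> (n::nat) \<in> prime_products R"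
  by (induction n) (auto simp: ideals_set_simps intro: ideal_products.one prime_products_mult)

lemma general_ZPI_ring_iff:
  "general_ZPI_ring R \<longleftrightarrow> (\<forall>I. ideal I R \<longrightarrow> I \<in> prime_products R)"
proof -
  have "general_ZPI_ring R \<longleftrightarrow> (\<forall>I. proper_ideal I R \<longrightarrow> I \<in> prime_products R)"
    using proper_ideal_products_iff_finprod[of "{P. primeideal P R}"] primeideal_ideal
    by (simp add: general_ZPI_ring_def)
  then show ?thesis using ideal_products.one[of R] by (auto simp: proper_ideal_def)
qed

text \<open>A prime containing a product contains one of the factors, and commutativity moves that
  factor to the front.\<close>

lemma prime_products_factor:
  assumes "I \<in> prime_products R" "primeideal Q R" "I \<subseteq> Q"
  obtains P J where "primeideal P R" "P \<subseteq> Q" "J \<in> prime_products R" "I = P \<cdot> J"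
proof -
  have "\<exists>P J. primeideal P R \<and> P \<subseteq> Q \<and> J \<in> prime_products R \<and> I = P \<cdot> J"
    using assms(1,3)
  proof induction
    case one
    then show ?case using primeideal_one_notin[OF assms(2)] by blast
  next
    case (mult K I)
    then have K: "primeideal K R" "ideal K R" and I: "ideal I R"
      using primeideal_ideal prime_products_ideal by auto
    show ?case
    proof (cases "K \<subseteq> Q")
      case True
      then show ?thesis using K mult.hyps by blast
    next
      case False
      then have "I \<subseteq> Q" using primeideal_divides_ideal_prod[OF assms(2) K(2) I] mult.prems by blast
      then obtain P J where P: "primeideal P R" "P \<subseteq> Q" "J \<in> prime_products R" "I = P \<cdot> J"
        using mult.IH by blast
      have "K \<cdot> I = P \<cdot> (K \<cdot> J)"
        using ideal_prod_assoc ideal_prod_commute P K primeideal_ideal prime_products_ideal by metis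
      then show ?thesis using P K ideal_products.mult[of K "{P. primeideal P R}" J] by blast
    qed
  qed
  then show thesis using that by blast
qed

text \<open>\<open>F\<close> consists of the prime factors in one factorization of \<open>I\<close>.
  In particular all minimal primes over \<open>I\<close> occur in it.\<close>

lemma prime_products_finite_factors:
  assumes "I \<in> prime_products R"
  obtains F where "finite F" "\<And>P. P \<in> F \<Longrightarrow> primeideal P R \<and> I \<subseteq> P"
    "\<And>Q. primeideal Q R \<Longrightarrow> I \<subseteq> Q \<Longrightarrow> \<exists>P\<in>F. P \<subseteq> Q"
proof -
  have "\<exists>F. finite F \<and> (\<forall>P\<in>F. primeideal P R \<and> I \<subseteq> P) \<and> (\<forall>Q. primeideal Q R \<and> I \<subseteq> Q \<longrightarrow> (\<exists>P\<in>F. P \<subseteq> Q))"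
    using assms
  proof induction
    case one
    have "\<not> carrier R \<subseteq> Q" if "primeideal Q R" for Q using primeideal_one_notin[OF that] by blast
    then show ?case by (intro exI[of _ "{}"]) simp
  next
    case (mult K I)
    then have K: "primeideal K R" "ideal K R" and I: "ideal I R"
      using primeideal_ideal prime_products_ideal by auto
    obtain F where F: "finite F" "\<forall>P\<in>F. primeideal P R \<and> I \<subseteq> P"
        "\<forall>Q. primeideal Q R \<and> I \<subseteq> Q \<longrightarrow> (\<exists>P\<in>F. P \<subseteq> Q)"
      using mult.IH by blast
    have sub: "K \<cdot> I \<subseteq> K" "K \<cdot> I \<subseteq> I" using ideal_prod_inter[OF K(2) I] by auto
    show ?case
    proof (intro exI[of _ "insert K F"] conjI allI impI)
      show "\<forall>P\<in>insert K F. primeideal P R \<and> K \<cdot> I \<subseteq> P" using F(2) K sub by auto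
      show "\<exists>P\<in>insert K F. P \<subseteq> Q" if "primeideal Q R \<and> K \<cdot> I \<subseteq> Q" for Q
      proof -
        have "K \<subseteq> Q \<or> I \<subseteq> Q"
          using primeideal_divides_ideal_prod[of Q K I] that K(2) I by simp
        then show ?thesis using F(3) that by auto
      qed
    qed (use F(1) in simp)
  qed
  then obtain F where "finite F" "\<forall>P\<in>F. primeideal P R \<and> I \<subseteq> P"
      "\<forall>Q. primeideal Q R \<and> I \<subseteq> Q \<longrightarrow> (\<exists>P\<in>F. P \<subseteq> Q)"
    by (elim exE conjE)
  then show thesis by (intro that[of F]) simp_all
qed

text \<open>A minimal member of the finite set of prime factors inside \<open>Q\<close> will do: a
  prime over \<open>I\<close> inside it again lies above a factor, which can only be that
  member.\<close>

lemma prime_products_minimal_prime: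
  assumes "I \<in> prime_products R" "primeideal Q R" "I \<subseteq> Q"
  obtains P where "primeideal P R" "I \<subseteq> P" "P \<subseteq> Q"
    "\<And>P'. primeideal P' R \<Longrightarrow> I \<subseteq> P' \<Longrightarrow> P' \<subseteq> P \<Longrightarrow> P' = P"
proof -
  obtain F where F: "finite F" "\<And>P. P \<in> F \<Longrightarrow> primeideal P R \<and> I \<subseteq> P"
    "\<And>Q. primeideal Q R \<Longrightarrow> I \<subseteq> Q \<Longrightarrow> \<exists>P\<in>F. P \<subseteq> Q"
    by (rule prime_products_finite_factors[OF assms(1)]) simp
  let ?F = "{P \<in> F. P \<subseteq> Q}"
  have "finite ?F" "?F \<noteq> {}" using F(1) F(3)[OF assms(2,3)] by auto
  then obtain P where "P \<in> ?F" "\<forall>P'\<in>?F. P' \<subseteq> P \<longrightarrow> P = P'"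
    by (rule bexE[OF finite_has_minimal])
  then have P: "P \<in> F" "P \<subseteq> Q" and min: "\<And>P'. P' \<in> ?F \<Longrightarrow> P' \<subseteq> P \<Longrightarrow> P' = P"
    by (simp, simp, metis)
  have "P' = P" if P': "primeideal P' R" "I \<subseteq> P'" "P' \<subseteq> P" for P'
  proof -
    obtain P'' where "P'' \<in> F" "P'' \<subseteq> P'" using F(3)[OF P'(1,2)] by blast
    then show ?thesis using min[of P''] P P' by auto
  qed
  then show thesis using F(2)[OF P(1)] P by (intro that[of P]) simp_all
qed

text \<open>A factor not contained in \<open>Q\<close> becomes the unit ideal locally; a factor
  inside \<open>Q\<close> contains \<open>I\<close> and therefore equals \<open>Q\<close> by
  hypothesis. The exponent counts the factors equal to \<open>Q\<close>.\<close>

lemma prime_products_sat_power: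
  assumes "I \<in> prime_products R" "primeideal Q R"
    and "\<And>P. primeideal P R \<Longrightarrow> I \<subseteq> P \<Longrightarrow> P \<subseteq> Q \<Longrightarrow> P = Q"
  obtains n :: nat where "sat Q I = sat Q (Q [^]\<^bsub>ideals_set R\<^esub> n)"
proof -
  have "\<exists>n::nat. sat Q I = sat Q (Q [^]\<^bsub>ideals_set R\<^esub> n)"
    using assms(1,3)
  proof induction
    case one
    show ?case using ideal_power_0[of Q] by metis
  next
    case (mult K I)
    then have K: "primeideal K R" "ideal K R" and I: "ideal I R"
      using primeideal_ideal prime_products_ideal by auto
    have sub: "K \<cdot> I \<subseteq> K" "K \<cdot> I \<subseteq> I" using ideal_prod_inter[OF K(2) I] by auto
    then obtain n :: nat where n: "sat Q I = sat Q (Q [^]\<^bsub>ideals_set R\<^esub> n)"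
      using mult by (meson order_trans)
    show ?case
    proof (cases "K \<subseteq> Q")
      case True
      then have KQ: "K = Q" using mult.prems K sub by blast
      note Q = primeideal_ideal[OF assms(2)]
      have "sat Q (I \<cdot> Q) = sat Q ((Q [^]\<^bsub>ideals_set R\<^esub> n) \<cdot> Q)"
        using sat_prod_cong[OF assms(2) I Q ideal_power_ideal[OF Q] Q n refl] .
      then show ?thesis
        unfolding KQ ideal_power_Suc[symmetric] ideal_prod_commute[OF Q I] by blast
    next
      case False
      then have "sat Q (I \<cdot> K) = sat Q I" using sat_prod_drop[OF assms(2) I K(2)] by blast
      then show ?thesis using n unfolding ideal_prod_commute[OF K(2) I] by auto
    qed
  qed
  then show thesis using that by blast
qed

section \<open>Arithmetical rings\<close>

lemma chained_ring_iff:
  "chained_ring R \<longleftrightarrow> (\<forall>a\<in>carrier R. \<forall>b\<in>carrier R. a \<in> PIdl b \<or> b \<in> PIdl a)"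
proof
  assume *: "chained_ring R"
  show "\<forall>a\<in>carrier R. \<forall>b\<in>carrier R. a \<in> PIdl b \<or> b \<in> PIdl a"
  proof (intro ballI)
    fix a b assume ab: "a \<in> carrier R" "b \<in> carrier R"
    then have "PIdl a \<subseteq> PIdl b \<or> PIdl b \<subseteq> PIdl a"
      using * cgenideal_ideal unfolding chained_ring_def by blast
    then show "a \<in> PIdl b \<or> b \<in> PIdl a" using cgenideal_self ab by blast
  qed
next
  assume *: "\<forall>a\<in>carrier R. \<forall>b\<in>carrier R. a \<in> PIdl b \<or> b \<in> PIdl a"
  show "chained_ring R"
    unfolding chained_ring_def
  proof (intro allI impI)
    fix I J assume I: "ideal I R" and J: "ideal J R"
    have "J \<subseteq> I" if "\<not> I \<subseteq> J"
    proof
      fix b assume b: "b \<in> J"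
      from that obtain a where a: "a \<in> I" "a \<notin> J" by blast
      have "a \<notin> PIdl b" using a(2) cgenideal_minimal[OF J b] by blast
      then have "b \<in> PIdl a" using * a(1) b I J ideal.Icarr by metis
      then show "b \<in> I" using cgenideal_minimal[OF I a(1)] by blast
    qed
    then show "I \<subseteq> J \<or> J \<subseteq> I" by blast
  qed
qed

section \<open>Principal ideals of the localization in terms of saturations\<close>

context
  fixes M assumes M: "primeideal M R"
begin

private abbreviation frac where "frac a s \<equiv> frac_rel R (carrier R - M) `` {(a, s)}"

private lemma submonoid: "submonoid (carrier R - M) R"
  by unfold_locales (use primeideal_mult_notin[OF M] primeideal_one_notin[OF M] in auto)

private lemma equiv: "equiv (carrier R \<times> (carrier R - M)) (frac_rel R (carrier R - M))"
  by (rule equiv_frac_rel[OF is_cring submonoid])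

private lemma frac_eq_iff:
  assumes "a \<in> carrier R" "b \<in> carrier R" "s \<in> carrier R - M" "t \<in> carrier R - M"
  shows "frac a s = frac b t \<longleftrightarrow> (\<exists>u\<in>carrier R - M. u \<otimes> (a \<otimes> t) = u \<otimes> (b \<otimes> s))"
  using eq_equiv_class_iff[OF equiv, of "(a, s)" "(b, t)"] assms by (simp add: frac_rel_def)

private lemma carrier_localization_at:
  "carrier (localization_at R M) = {frac a s |a s. a \<in> carrier R \<and> s \<in> carrier R - M}"
  by (auto simp: localization_at_def localization_def quotient_def)

private lemma frac_mult:
  assumes "a \<in> carrier R" "b \<in> carrier R" "s \<in> carrier R - M" "t \<in> carrier R - M"
  shows "frac a s \<otimes>\<^bsub>localization_at R M\<^esub> frac b t = frac (a \<otimes> b) (s \<otimes> t)"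
proof -
  \<comment> \<open>Multiplication in \<open>localization\<close> is a union over all
    representatives; by \<open>eq\<close> they all contribute the same class, so the union
    collapses.\<close>
  have eq: "frac (a' \<otimes> b') (s' \<otimes> t') = frac (a \<otimes> b) (s \<otimes> t)"
    if 1: "(a', s') \<in> frac a s" and 2: "(b', t') \<in> frac b t" for a' s' b' t'
  proof -
    from 1 obtain u where u: "u \<in> carrier R - M" "u \<otimes> (a \<otimes> s') = u \<otimes> (a' \<otimes> s)"
      and c1: "a' \<in> carrier R" "s' \<in> carrier R - M" by (auto simp: frac_rel_def)
    from 2 obtain v where v: "v \<in> carrier R - M" "v \<otimes> (b \<otimes> t') = v \<otimes> (b' \<otimes> t)"
      and c2: "b' \<in> carrier R" "t' \<in> carrier R - M" by (auto simp: frac_rel_def)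
    have c: "u \<in> carrier R" "v \<in> carrier R" "s \<in> carrier R" "t \<in> carrier R" "s' \<in> carrier R" "t' \<in> carrier R"
      using u v c1 c2 assms by auto
    have "(u \<otimes> v) \<otimes> ((a' \<otimes> b') \<otimes> (s \<otimes> t)) = (u \<otimes> (a' \<otimes> s)) \<otimes> (v \<otimes> (b' \<otimes> t))"
      using assms(1,2) c c1(1) c2(1) by (simp add: m_ac)
    also have "\<dots> = (u \<otimes> v) \<otimes> ((a \<otimes> b) \<otimes> (s' \<otimes> t'))"
      unfolding u(2)[symmetric] v(2)[symmetric] using assms(1,2) c by (simp add: m_ac)
    finally show ?thesis
      using assms c1 c2 primeideal_mult_notin[OF M] u(1) v(1)
      by (subst frac_eq_iff) (auto intro!: bexI[of _ "u \<otimes> v"])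
  qed
  have self: "(a, s) \<in> frac a s" "(b, t) \<in> frac b t"
    using assms equiv by (auto simp: equiv_def refl_on_def)
  have "frac a s \<otimes>\<^bsub>localization_at R M\<^esub> frac b t =
    (\<Union>x\<in>frac a s. \<Union>y\<in>frac b t. frac (fst x \<otimes> fst y) (snd x \<otimes> snd y))"
    by (simp add: localization_at_def localization_def split_def)
  also have "\<dots> = (\<Union>x\<in>frac a s. \<Union>y\<in>frac b t. frac (a \<otimes> b) (s \<otimes> t))"
    using eq by (intro SUP_cong refl) auto
  also have "\<dots> = frac (a \<otimes> b) (s \<otimes> t)" using self by blast
  finally show ?thesis .
qed

text \<open>Denominators are units of the localization, so divisibility of fractions depends only on
  the numerators, up to a multiplier outside \<open>M\<close>. This lets saturations take the place
  of fractions.\<close>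

private lemma frac_in_cgenideal_iff:
  assumes "a \<in> carrier R" "b \<in> carrier R" "s \<in> carrier R - M" "t \<in> carrier R - M"
  shows "frac a s \<in> PIdl\<^bsub>localization_at R M\<^esub> (frac b t) \<longleftrightarrow> a \<in> sat M (PIdl b)"
proof
  interpret L: cring "localization_at R M" by (rule localization_at_cring[OF M])
  have cs: "s \<in> carrier R" "t \<in> carrier R" using assms by auto
  {
    assume "frac a s \<in> PIdl\<^bsub>localization_at R M\<^esub> (frac b t)"
    then obtain c r where c: "c \<in> carrier R" "r \<in> carrier R - M"
      and "frac a s = frac c r \<otimes>\<^bsub>localization_at R M\<^esub> frac b t"
      by (auto simp: L.PIdl_iff carrier_localization_at)
    then have "frac a s = frac (c \<otimes> b) (r \<otimes> t)" using frac_mult assms by simp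
    then obtain u where u: "u \<in> carrier R - M" "u \<otimes> (a \<otimes> (r \<otimes> t)) = u \<otimes> (c \<otimes> b \<otimes> s)"
      using frac_eq_iff[of a "c \<otimes> b" s "r \<otimes> t"] assms c primeideal_mult_notin[OF M] by auto
    have cc: "r \<in> carrier R" "u \<in> carrier R" using c u by auto
    have "u \<otimes> (r \<otimes> t) \<otimes> a = u \<otimes> (a \<otimes> (r \<otimes> t))" using cc cs c assms by (simp add: m_ac)
    also have "\<dots> = (u \<otimes> c \<otimes> s) \<otimes> b" unfolding u(2) using cc cs c assms by (simp add: m_ac)
    finally have "u \<otimes> (r \<otimes> t) \<otimes> a \<in> PIdl b" using cc cs c assms by (auto simp: PIdl_iff)
    then show "a \<in> sat M (PIdl b)"
      using primeideal_mult_notin[OF M] u c assms by (intro satI[of "u \<otimes> (r \<otimes> t)"]) auto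
  next
    assume "a \<in> sat M (PIdl b)"
    then obtain u r where u: "u \<in> carrier R - M" "r \<in> carrier R" "u \<otimes> a = r \<otimes> b"
      by (auto simp: sat_iff PIdl_iff)
    have us: "u \<otimes> s \<in> carrier R - M" using u assms primeideal_mult_notin[OF M] by auto
    have uc: "u \<in> carrier R" using u by auto
    have "\<one> \<otimes> (a \<otimes> (u \<otimes> s \<otimes> t)) = (u \<otimes> a) \<otimes> (s \<otimes> t)" using uc cs assms by (simp add: m_ac)
    also have "\<dots> = \<one> \<otimes> (r \<otimes> t \<otimes> b \<otimes> s)" unfolding u(3) using u cs assms by (simp add: m_ac)
    finally have "frac a s = frac (r \<otimes> t \<otimes> b) (u \<otimes> s \<otimes> t)"
      using frac_eq_iff[of a "r \<otimes> t \<otimes> b" s "u \<otimes> s \<otimes> t"] u us cs assms primeideal_mult_notin[OF M]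
        primeideal_one_notin[OF M] by (auto intro!: bexI[of _ \<one>])
    also have "\<dots> = frac (r \<otimes> t) (u \<otimes> s) \<otimes>\<^bsub>localization_at R M\<^esub> frac b t"
      using frac_mult[of "r \<otimes> t" b "u \<otimes> s" t] u us cs assms by simp
    finally show "frac a s \<in> PIdl\<^bsub>localization_at R M\<^esub> (frac b t)"
      using u cs us unfolding L.PIdl_iff carrier_localization_at by blast
  }
qed

lemma chained_ring_localization_at_iff:
  "chained_ring (localization_at R M) \<longleftrightarrow>
    (\<forall>a\<in>carrier R. \<forall>b\<in>carrier R. a \<in> sat M (PIdl b) \<or> b \<in> sat M (PIdl a))"
proof -
  interpret L: cring "localization_at R M" by (rule localization_at_cring[OF M])
  have "chained_ring (localization_at R M) \<longleftrightarrow>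
    (\<forall>a\<in>carrier R. \<forall>s\<in>carrier R - M. \<forall>b\<in>carrier R. \<forall>t\<in>carrier R - M.
      frac a s \<in> PIdl\<^bsub>localization_at R M\<^esub> (frac b t) \<or> frac b t \<in> PIdl\<^bsub>localization_at R M\<^esub> (frac a s))"
    unfolding L.chained_ring_iff carrier_localization_at by blast
  also have "\<dots> \<longleftrightarrow> (\<forall>a\<in>carrier R. \<forall>s\<in>carrier R - M. \<forall>b\<in>carrier R. \<forall>t\<in>carrier R - M.
      a \<in> sat M (PIdl b) \<or> b \<in> sat M (PIdl a))"
    by (intro ball_cong refl) (simp only: frac_in_cgenideal_iff)
  finally show ?thesis using primeideal_one_notin[OF M] by blast
qed

end

lemma arithmetical_ring_iff:
  "arithmetical_ring R \<longleftrightarrow> (\<forall>M. maximalideal M R \<longrightarrow>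
    (\<forall>a\<in>carrier R. \<forall>b\<in>carrier R. a \<in> sat M (PIdl b) \<or> b \<in> sat M (PIdl a)))"
  using chained_ring_localization_at_iff maximalideal_prime
  by (simp add: arithmetical_ring_def)

section \<open>Locally principal maximal ideals\<close>

lemma sat_nakayama_zero:
  assumes "primeideal Q R" "a \<in> carrier R" "s \<in> carrier R - Q" "q \<in> Q" "s \<otimes> a = q \<otimes> a"
  shows "a \<in> sat Q {\<zero>}"
proof (rule sat_nakayama[OF assms(1) zeroideal assms(2-4)])
  show "s \<otimes> a \<ominus> q \<otimes> a \<in> {\<zero>}"
    unfolding assms(5) using ideal.Icarr[OF primeideal_ideal[OF assms(1)] assms(4)] assms(2)
    by (simp add: a_minus_def r_neg)
qed

text \<open>If \<open>M\<close> is the only prime between \<open>PIdl a\<close> and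
  \<open>M\<close>, the factorization of \<open>PIdl a\<close> yields a power of \<open>M\<close>.
  Otherwise \<open>PIdl a = P \<cdot> J\<close> with a prime \<open>P\<close> strictly below
  \<open>M\<close>. Then \<open>x\<close> is not in \<open>P\<close>, so \<open>P = x P\<close> and
  hence \<open>(a) = x (a)\<close> locally, and Nakayama's lemma makes \<open>a\<close> locally
  zero.\<close>

lemma sat_dichotomy_of_locally_principal:
  assumes M: "maximalideal M R" and x: "x \<in> M" "M \<subseteq> sat M (PIdl x)"
    and a: "a \<in> carrier R" "PIdl a \<in> prime_products R"
  shows "a \<in> sat M {\<zero>} \<or> (\<exists>n::nat. sat M (PIdl a) = sat M (M [^]\<^bsub>ideals_set R\<^esub> n))"
proof (cases "\<forall>P. primeideal P R \<longrightarrow> PIdl a \<subseteq> P \<longrightarrow> P \<subseteq> M \<longrightarrow> P = M")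
  case True
  then show ?thesis
    using prime_products_sat_power[OF a(2) maximalideal_prime[OF M]] by metis
next
  case False
  then obtain P0 where P0: "primeideal P0 R" "PIdl a \<subseteq> P0" "P0 \<subseteq> M" "P0 \<noteq> M" by blast
  obtain P J where P: "primeideal P R" "P \<subseteq> P0" and J: "J \<in> prime_products R" and PJ: "PIdl a = P \<cdot> J"
    using prime_products_factor[OF a(2) P0(1,2)] .
  note M' = maximalideal_prime[OF M]
  note PI = primeideal_ideal[OF P(1)] and JI = prime_products_ideal[OF J]
  have xc: "x \<in> carrier R" by (rule ideal.Icarr[OF primeideal_ideal[OF M'] x(1)])
  have xP: "x \<notin> P"
  proof
    assume "x \<in> P"
    then have "PIdl x \<subseteq> P" using cgenideal_minimal[OF PI] by blast
    then have "M \<subseteq> sat M P" using x(2) sat_mono[of "PIdl x" P M] by simp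
    then have "M \<subseteq> P" using sat_prime[OF M' P(1)] P P0 by simp
    then show False using P P0 by blast
  qed
  \<comment> \<open>Locally \<open>p\<close> is \<open>r \<otimes> x\<close>, and \<open>r\<close>
    lies in \<open>P\<close> since \<open>x\<close> does not. So \<open>p \<otimes> j\<close> is
    \<open>x \<otimes> (r \<otimes> j)\<close> locally, with \<open>r \<otimes> j\<close> in
    \<open>PIdl a\<close>.\<close>
  have "P \<cdot> J \<subseteq> sat M (PIdl (x \<otimes> a))"
  proof (rule ideal_prod_least)
    show "ideal (sat M (PIdl (x \<otimes> a))) R"
      using sat_ideal[OF M'] cgenideal_ideal xc a by simp
    fix p j assume p: "p \<in> P" and j: "j \<in> J"
    then have "p \<in> sat M (PIdl x)" using P P0 x by blast
    then obtain s r where s: "s \<in> carrier R - M" "r \<in> carrier R" "s \<otimes> p = r \<otimes> x"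
      by (auto simp: sat_iff PIdl_iff)
    have c: "p \<in> carrier R" "j \<in> carrier R" using p j ideal.Icarr[OF PI] ideal.Icarr[OF JI] by auto
    have "r \<otimes> x \<in> P" using ideal_mult[OF PI p] s by (metis DiffD1)
    then have "r \<in> P" using primeideal.I_prime[OF P(1) s(2) xc] xP by blast
    then have "r \<otimes> j \<in> PIdl a" unfolding PJ using j by (rule ideal_prod.prod)
    then obtain d where d: "d \<in> carrier R" "r \<otimes> j = d \<otimes> a" by (auto simp: PIdl_iff)
    have sc: "s \<in> carrier R" using s by blast
    have "s \<otimes> (p \<otimes> j) = (s \<otimes> p) \<otimes> j" using sc c by (simp add: m_assoc)
    also have "\<dots> = x \<otimes> (r \<otimes> j)" using s xc c by (simp add: m_ac)
    also have "\<dots> = d \<otimes> (x \<otimes> a)" using d xc a by (simp add: m_ac)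
    finally have "s \<otimes> (p \<otimes> j) \<in> PIdl (x \<otimes> a)" using d(1) by (auto simp: PIdl_iff)
    then show "p \<otimes> j \<in> sat M (PIdl (x \<otimes> a))" using s(1) c by (intro satI) auto
  qed
  then have "a \<in> sat M (PIdl (x \<otimes> a))" using PJ cgenideal_self[OF a(1)] by blast
  then obtain s r where s: "s \<in> carrier R - M" "r \<in> carrier R" "s \<otimes> a = r \<otimes> (x \<otimes> a)"
    by (auto simp: sat_iff PIdl_iff)
  have "s \<otimes> a = (r \<otimes> x) \<otimes> a" using s xc a by (simp add: m_assoc)
  then have "a \<in> sat M {\<zero>}"
    using sat_nakayama_zero[OF M' a(1) s(1) ideal_mult[OF primeideal_ideal[OF M'] x(1) s(2)]] by blast
  then show ?thesis ..
qed

text \<open>The powers of \<open>M\<close> form a chain and the zero ideal lies below them, so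
  principal ideals are locally comparable.\<close>

lemma arithmetical_ring_of_sat_dichotomy:
  assumes "\<And>M a. maximalideal M R \<Longrightarrow> a \<in> carrier R \<Longrightarrow>
    a \<in> sat M {\<zero>} \<or> (\<exists>n::nat. sat M (PIdl a) = sat M (M [^]\<^bsub>ideals_set R\<^esub> n))"
  shows "arithmetical_ring R"
  unfolding arithmetical_ring_iff
proof (intro allI impI ballI)
  fix M a b assume M: "maximalideal M R" and ab: "a \<in> carrier R" "b \<in> carrier R"
  note M' = maximalideal_prime[OF M]
  have zero: "sat M {\<zero>} \<subseteq> sat M (PIdl c)" if "c \<in> carrier R" for c
    using cgenideal_ideal[OF that] ideal_zero by (intro sat_mono) auto
  have self: "c \<in> sat M (PIdl c)" if "c \<in> carrier R" for c
    using sat_supset[OF M' cgenideal_ideal[OF that]] cgenideal_self[OF that] by blast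
  have dec: "sat M (M [^]\<^bsub>ideals_set R\<^esub> n) \<subseteq> sat M (M [^]\<^bsub>ideals_set R\<^esub> m)" if "m \<le> n" for m n :: nat
    using ideal_power_decreasing[OF primeideal_ideal[OF M'] that] by (rule sat_mono)
  consider "a \<in> sat M {\<zero>}" | "b \<in> sat M {\<zero>}" | m n :: nat where
    "sat M (PIdl a) = sat M (M [^]\<^bsub>ideals_set R\<^esub> m)" "sat M (PIdl b) = sat M (M [^]\<^bsub>ideals_set R\<^esub> n)"
    using assms[OF M ab(1)] assms[OF M ab(2)] by blast
  then show "a \<in> sat M (PIdl b) \<or> b \<in> sat M (PIdl a)"
  proof cases
    case (3 m n)
    then show ?thesis using dec[of m n] dec[of n m] self ab nat_le_linear[of m n] by blast
  qed (use zero ab in auto)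
qed

lemma ideal_image_mult:
  assumes "ideal Q R" "y \<in> carrier R" shows "ideal ((\<lambda>q. q \<otimes> y) ` Q) R"
proof (rule ideal_intro)
  note c = ideal.Icarr[OF assms(1)]
  show "(\<lambda>q. q \<otimes> y) ` Q \<subseteq> carrier R" using c assms(2) by auto
  show "\<zero> \<in> (\<lambda>q. q \<otimes> y) ` Q" using ideal_zero[OF assms(1)] assms(2) by force
  show "u \<oplus> v \<in> (\<lambda>q. q \<otimes> y) ` Q" if "u \<in> (\<lambda>q. q \<otimes> y) ` Q" "v \<in> (\<lambda>q. q \<otimes> y) ` Q" for u v
  proof -
    from that obtain p q where pq: "p \<in> Q" "q \<in> Q" "u = p \<otimes> y" "v = q \<otimes> y" by blast
    then have "u \<oplus> v = (p \<oplus> q) \<otimes> y" using c assms(2) by (simp add: l_distr)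
    then show ?thesis using ideal_add[OF assms(1)] pq by blast
  qed
  show "r \<otimes> u \<in> (\<lambda>q. q \<otimes> y) ` Q" if u: "u \<in> (\<lambda>q. q \<otimes> y) ` Q" and r: "r \<in> carrier R" for u r
  proof -
    from u obtain p where p: "p \<in> Q" "u = p \<otimes> y" by blast
    then have "r \<otimes> u = (r \<otimes> p) \<otimes> y" using c assms(2) r by (simp add: m_assoc)
    then show ?thesis using ideal_mult[OF assms(1) p(1) r] by blast
  qed
qed

text \<open>If every product \<open>a b\<close> only yielded \<open>c \<in> Q\<close>, then \<open>y \<in> Q y + K\<close>, which Nakayama's lemma excludes.\<close>

lemma principal_factorization_cofactor:
  assumes Q: "primeideal Q R" and K: "ideal K R" and y: "y \<in> carrier R" "y \<notin> sat Q K"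
    and AB: "PIdl y <+> K = A \<cdot> B"
  obtains a b c k where "a \<in> A" "b \<in> B" "c \<in> carrier R - Q" "k \<in> K" "a \<otimes> b = c \<otimes> y \<oplus> k"
proof -
  have "\<exists>a\<in>A. \<exists>b\<in>B. \<exists>c\<in>carrier R - Q. \<exists>k\<in>K. a \<otimes> b = c \<otimes> y \<oplus> k"
  proof (rule ccontr)
    assume neg: "\<not> ?thesis"
    let ?N = "(\<lambda>q. q \<otimes> y) ` Q <+> K"
    have "A \<cdot> B \<subseteq> ?N"
    proof (rule ideal_prod_least)
      show "ideal ?N R" by (intro add_ideals ideal_image_mult primeideal_ideal Q y K)
      fix a b assume ab: "a \<in> A" "b \<in> B"
      then have "a \<otimes> b \<in> PIdl y <+> K" unfolding AB by (rule ideal_prod.prod)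
      then obtain c k where ck: "c \<in> carrier R" "k \<in> K" "a \<otimes> b = c \<otimes> y \<oplus> k"
        by (auto simp: ideal_add_iff PIdl_iff)
      then have "c \<in> Q" using neg ab by blast
      then show "a \<otimes> b \<in> ?N" using ck by (auto simp: ideal_add_iff)
    qed
    moreover have "y \<in> PIdl y <+> K"
      using ideal_add_supset(1)[OF cgenideal_ideal K] cgenideal_self y(1) by blast
    ultimately have "y \<in> ?N" using AB by blast
    then obtain q k where qk: "q \<in> Q" "k \<in> K" "y = q \<otimes> y \<oplus> k" by (auto simp: ideal_add_iff)
    then have c: "q \<in> carrier R" "k \<in> carrier R"
      using ideal.Icarr[OF primeideal_ideal[OF Q]] ideal.Icarr[OF K] by auto
    have "\<one> \<otimes> y \<ominus> q \<otimes> y = (q \<otimes> y \<oplus> k) \<ominus> q \<otimes> y" using qk(3) y by simp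
    also have "\<dots> = k" using c y(1) by algebra
    finally show False
      using sat_nakayama[OF Q K y(1) primeideal_one_notin[OF Q] qk(1)] qk(2) y(2) by simp
  qed
  then show thesis using that by blast
qed

text \<open>Unless \<open>M\<close> is locally zero, take \<open>a\<close> in \<open>M\<close> that
  is not locally zero and factor \<open>PIdl a = P \<cdot> J\<close> with \<open>P\<close> inside
  \<open>M\<close>. Some \<open>p\<close> in \<open>P\<close> and \<open>b\<close> in
  \<open>J\<close> have product \<open>a\<close> up to a local unit. Comparability and Nakayama's
  lemma show that \<open>p\<close> generates first \<open>P\<close> and then \<open>M\<close>
  locally.\<close>

lemma arithmetical_maximal_locally_principal:
  assumes M: "maximalideal M R"
    and cmp: "\<And>a b. a \<in> carrier R \<Longrightarrow> b \<in> carrier R \<Longrightarrow> a \<in> sat M (PIdl b) \<or> b \<in> sat M (PIdl a)"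
    and PP: "\<And>a. a \<in> carrier R \<Longrightarrow> PIdl a \<in> prime_products R"
  shows "\<exists>x\<in>M. M \<subseteq> sat M (PIdl x)"
proof (cases "M \<subseteq> sat M {\<zero>}")
  note M' = maximalideal_prime[OF M]
  note MI = primeideal_ideal[OF M']
  case True
  then have "M \<subseteq> sat M (PIdl \<zero>)"
    using sat_mono[of "{\<zero>}" "PIdl \<zero>" M] ideal_zero[OF cgenideal_ideal[OF zero_closed]] by blast
  then show ?thesis using ideal_zero[OF MI] by blast
next
  case False
  note M' = maximalideal_prime[OF M]
  note MI = primeideal_ideal[OF M']
  note notin = primeideal_mult_notin[OF M']
  note Mc = ideal.Icarr[OF MI]
  note nak = sat_nakayama_zero[OF M']
  note sat0 = sat_ideal[OF M' zeroideal]
  have sat_cancel: "v \<in> sat M {\<zero>}" if "u \<in> carrier R - M" "v \<in> carrier R" "u \<otimes> v \<in> sat M {\<zero>}" for u v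
    using satI[OF that(3,1,2)] sat_sat[OF M' zeroideal] by simp
  from False obtain a where a: "a \<in> M" "a \<notin> sat M {\<zero>}" by blast
  then have ac: "a \<in> carrier R" using Mc by blast
  obtain P J where P: "primeideal P R" "P \<subseteq> M" and J: "J \<in> prime_products R" and PJ: "PIdl a = P \<cdot> J"
    using prime_products_factor[OF PP[OF ac] M'] cgenideal_minimal[OF MI a(1)] .
  note PI = primeideal_ideal[OF P(1)] and JI = prime_products_ideal[OF J]
  \<comment> \<open>The zero ideal is added to match the form of
    \<open>principal_factorization_cofactor\<close>.\<close>
  have "{\<zero>} \<subseteq> PIdl a" using ideal_zero[OF cgenideal_ideal[OF ac]] by simp
  then have "PIdl a <+> {\<zero>} = P \<cdot> J"
    using ideal_add_least[OF cgenideal_ideal[OF ac] order_refl, of "{\<zero>}"]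
      ideal_add_supset(1)[OF cgenideal_ideal[OF ac] zeroideal] PJ by simp
  then obtain p b c k where p: "p \<in> P" and b: "b \<in> J" and c: "c \<in> carrier R - M"
    and "k \<in> {\<zero>}" "p \<otimes> b = c \<otimes> a \<oplus> k"
    by (rule principal_factorization_cofactor[OF M' zeroideal ac a(2)])
  then have pb: "p \<otimes> b = c \<otimes> a" using ac by auto
  have pc: "p \<in> carrier R" "b \<in> carrier R" "c \<in> carrier R"
    using p b c ideal.Icarr[OF PI] ideal.Icarr[OF JI] by auto
  have psat: "p \<notin> sat M {\<zero>}"
  proof
    assume "p \<in> sat M {\<zero>}"
    then have "c \<otimes> a \<in> sat M {\<zero>}" using ideal_mult_r[OF sat0 _ pc(2)] pb by metis
    then show False using sat_cancel[OF c ac] a(2) by blast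
  qed
  \<comment> \<open>If \<open>i\<close> is not a local multiple of \<open>p\<close>, then locally
    \<open>p = r i\<close> with \<open>r\<close> in \<open>M\<close>. As \<open>i b\<close> lies in
    \<open>(a)\<close>, which is locally \<open>(p b)\<close>, it is a multiple of
    \<open>r (i b)\<close>. So \<open>i b\<close> vanishes locally, and with it \<open>p b\<close>
    and \<open>a\<close>.\<close>
  have P_sub: "i \<in> sat M (PIdl p)" if i: "i \<in> P" for i
  proof (rule ccontr)
    assume nin: "i \<notin> sat M (PIdl p)"
    have ic: "i \<in> carrier R" by (rule ideal.Icarr[OF PI i])
    then have "p \<in> sat M (PIdl i)" using cmp[OF ic pc(1)] nin by blast
    then obtain s r where s: "s \<in> carrier R - M" and r: "r \<in> carrier R" and sp: "s \<otimes> p = r \<otimes> i"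
      by (auto simp: sat_iff PIdl_iff)
    have sc: "s \<in> carrier R" using s by blast
    have "r \<in> M"
    proof (rule ccontr)
      assume "r \<notin> M"
      moreover have "r \<otimes> i \<in> PIdl p" using sp sc unfolding PIdl_iff by metis
      ultimately show False using nin satI r ic by blast
    qed
    have "i \<otimes> b \<in> PIdl a" unfolding PJ using i b by (rule ideal_prod.prod)
    then obtain d where d: "d \<in> carrier R" "i \<otimes> b = d \<otimes> a" by (auto simp: PIdl_iff)
    have "(c \<otimes> s) \<otimes> (i \<otimes> b) = s \<otimes> d \<otimes> (c \<otimes> a)"
      unfolding d(2) using d(1) sc pc ac by (simp add: m_ac)
    also have "\<dots> = d \<otimes> (s \<otimes> p) \<otimes> b"
      unfolding pb[symmetric] using d(1) sc pc by (simp add: m_ac)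
    also have "\<dots> = (d \<otimes> r) \<otimes> (i \<otimes> b)"
      unfolding sp using d(1) r ic pc by (simp add: m_assoc)
    finally have "i \<otimes> b \<in> sat M {\<zero>}"
      using nak[OF _ notin[OF c s] ideal_mult[OF MI \<open>r \<in> M\<close> d(1)]] ic pc by blast
    then have "r \<otimes> (i \<otimes> b) \<in> sat M {\<zero>}" using ideal_mult[OF sat0] r by blast
    moreover have "r \<otimes> (i \<otimes> b) = (s \<otimes> c) \<otimes> a"
    proof -
      have "r \<otimes> (i \<otimes> b) = (s \<otimes> p) \<otimes> b" using sp r ic pc by (simp add: m_assoc)
      also have "\<dots> = (s \<otimes> c) \<otimes> a" using pb sc pc ac by (simp add: m_assoc)
      finally show ?thesis .
    qed
    ultimately show False using sat_cancel[OF notin[OF s c] ac] a(2) by simp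
  qed
  \<comment> \<open>If \<open>y\<close> is not a local multiple of \<open>p\<close>, then locally
    \<open>p = r y\<close>, and \<open>y\<close> is not in \<open>P\<close>. So \<open>r\<close>
    lies in \<open>P\<close>, locally \<open>r = q p\<close>, and \<open>p = q y p\<close> forces
    \<open>p\<close> to vanish.\<close>
  have "y \<in> sat M (PIdl p)" if y: "y \<in> M" for y
  proof (rule ccontr)
    assume nin: "y \<notin> sat M (PIdl p)"
    note yc = Mc[OF y]
    have "p \<in> sat M (PIdl y)" using cmp[OF yc pc(1)] nin by blast
    then obtain s r where s: "s \<in> carrier R - M" and r: "r \<in> carrier R" and sp: "s \<otimes> p = r \<otimes> y"
      by (auto simp: sat_iff PIdl_iff)
    have sc: "s \<in> carrier R" using s by blast
    have "r \<otimes> y \<in> P" using sp ideal_mult[OF PI p sc] by simp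
    then have "r \<in> P" using primeideal.I_prime[OF P(1) r yc] P_sub nin by blast
    then have "r \<in> sat M (PIdl p)" by (rule P_sub)
    then obtain t q where t: "t \<in> carrier R - M" and q: "q \<in> carrier R" and tr: "t \<otimes> r = q \<otimes> p"
      by (auto simp: sat_iff PIdl_iff)
    have tc: "t \<in> carrier R" using t by blast
    have "(t \<otimes> s) \<otimes> p = (t \<otimes> r) \<otimes> y" using sp tc sc r yc pc by (simp add: m_assoc)
    also have "\<dots> = (q \<otimes> y) \<otimes> p" unfolding tr using q yc pc by (simp add: m_ac)
    finally show False
      using nak[OF pc(1) notin[OF t s] ideal_mult[OF MI y q]] psat by blast
  qed
  then show ?thesis using p P(2) by blast
qed

section \<open>Rings whose ideals are products of primes\<close>

text \<open>Where \<open>Q\<close> is locally idempotent, a generator can be discarded: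
  \<open>Q = Q Q\<close> lies locally in \<open>Q z + K\<close>, so Nakayama's lemma puts
  \<open>z\<close> into \<open>K\<close>.\<close>

lemma sat_nakayama_idempotent:
  assumes Q: "primeideal Q R" and QQ: "Q \<subseteq> sat Q (Q \<cdot> Q)" and K: "ideal K R" and z: "z \<in> Q"
    and le: "Q \<subseteq> sat Q (PIdl z <+> K)"
  shows "Q \<subseteq> sat Q K"
proof -
  note QI = primeideal_ideal[OF Q]
  note zc = ideal.Icarr[OF QI z]
  let ?N = "PIdl z <+> K" and ?L = "(\<lambda>q. q \<otimes> z) ` Q <+> K"
  have N: "ideal ?N R" by (intro add_ideals cgenideal_ideal zc K)
  have L: "ideal ?L R" by (intro add_ideals ideal_image_mult QI zc K)
  have "Q \<cdot> ?N \<subseteq> ?L"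
  proof (rule ideal_prod_least[OF L])
    fix q n assume q: "q \<in> Q" and "n \<in> ?N"
    then obtain r k where rk: "r \<in> carrier R" "k \<in> K" "n = r \<otimes> z \<oplus> k"
      by (auto simp: ideal_add_iff PIdl_iff)
    have c: "q \<in> carrier R" "k \<in> carrier R" using ideal.Icarr[OF QI q] ideal.Icarr[OF K rk(2)] by auto
    have "q \<otimes> n = (r \<otimes> q) \<otimes> z \<oplus> q \<otimes> k" unfolding rk(3) using c rk(1) zc by algebra
    then show "q \<otimes> n \<in> ?L"
      using ideal_mult[OF QI q rk(1)] ideal_mult[OF K rk(2) c(1)] by (auto simp: ideal_add_iff)
  qed
  moreover have "Q \<cdot> Q \<subseteq> sat Q (Q \<cdot> ?N)"
    by (rule sat_prod_mono[OF Q QI QI QI N sat_supset[OF Q QI] le])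
  ultimately have "Q \<cdot> Q \<subseteq> sat Q ?L" using sat_mono[of "Q \<cdot> ?N" ?L Q] by simp
  then have "Q \<subseteq> sat Q ?L" using sat_subset[OF Q L] QQ by (metis order_trans)
  then have "z \<in> sat Q ?L" using z by blast
  then obtain s q k where s: "s \<in> carrier R - Q" and q: "q \<in> Q" and k: "k \<in> K"
    and eq: "s \<otimes> z = q \<otimes> z \<oplus> k"
    by (auto simp: sat_iff ideal_add_iff)
  have c: "q \<in> carrier R" "k \<in> carrier R" using ideal.Icarr[OF QI q] ideal.Icarr[OF K k] by auto
  have "s \<otimes> z \<ominus> q \<otimes> z = k" unfolding eq using c zc by algebra
  then have "z \<in> sat Q K" using sat_nakayama[OF Q K zc s q] k by simp
  then have "PIdl z \<subseteq> sat Q K" by (rule cgenideal_minimal[OF sat_ideal[OF Q K]])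
  then have "?N \<subseteq> sat Q K"
    by (intro ideal_add_least sat_ideal Q K sat_supset)
  then show ?thesis using sat_subset[OF Q K] le by blast
qed

lemma sat_principal_of_notin_square:
  assumes PP: "\<And>I. ideal I R \<Longrightarrow> I \<in> prime_products R"
    and Q: "primeideal Q R" and x: "x \<in> Q" "x \<notin> sat Q (Q \<cdot> Q)"
  shows "Q \<subseteq> sat Q (PIdl x)"
proof
  note QI = primeideal_ideal[OF Q]
  note xc = ideal.Icarr[OF QI x(1)]
  fix z assume z: "z \<in> Q"
  note zc = ideal.Icarr[OF QI z]
  let ?I = "PIdl x <+> PIdl (z \<otimes> z)"
  have px: "ideal (PIdl x) R" and pz: "ideal (PIdl (z \<otimes> z)) R"
    using cgenideal_ideal xc zc by auto
  have I: "ideal ?I R" by (intro add_ideals px pz)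
  have IQ: "?I \<subseteq> Q"
    by (intro ideal_add_least QI cgenideal_minimal[OF QI] x(1) ideal_mult[OF QI z zc])
  have xI: "x \<in> ?I" using ideal_add_supset(1)[OF px pz] cgenideal_self[OF xc] by blast
  have zI: "z \<otimes> z \<in> ?I" using ideal_add_supset(2)[OF px pz] cgenideal_self[of "z \<otimes> z"] zc by blast
  obtain P J where P: "primeideal P R" "P \<subseteq> Q" and J: "J \<in> prime_products R" and PJ: "?I = P \<cdot> J"
    by (rule prime_products_factor[OF PP[OF I] Q IQ])
  note PI = primeideal_ideal[OF P(1)] and JI = prime_products_ideal[OF J]
  \<comment> \<open>Otherwise both factors lie in \<open>Q\<close> and \<open>x\<close> falls into
    \<open>Q \<cdot> Q\<close>. So \<open>J\<close> is locally the unit ideal and \<open>?I\<close>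
    agrees locally with \<open>P\<close>.\<close>
  have "\<not> J \<subseteq> Q"
  proof
    assume "J \<subseteq> Q"
    then have "?I \<subseteq> Q \<cdot> Q" unfolding PJ by (rule ideal_prod_mono[OF P(2)])
    then have "x \<in> Q \<cdot> Q" using xI by blast
    then show False using x(2) sat_supset[OF Q ideal_prod_is_ideal[OF QI QI]] by blast
  qed
  then obtain s where s: "s \<in> J" "s \<notin> Q" by blast
  note sc = ideal.Icarr[OF JI s(1)]
  have "z \<otimes> z \<in> P" using zI ideal_prod_inter[OF PI JI] unfolding PJ by blast
  then have "z \<in> P" using primeideal.I_prime[OF P(1) zc zc] by blast
  then have "z \<otimes> s \<in> ?I" unfolding PJ using s(1) by (rule ideal_prod.prod)
  then obtain r d where rd: "r \<in> carrier R" "d \<in> carrier R" "z \<otimes> s = r \<otimes> x \<oplus> d \<otimes> (z \<otimes> z)"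
    by (auto simp: ideal_add_iff PIdl_iff)
  \<comment> \<open>The square term moves to the left, where \<open>d \<otimes> z\<close> in
    \<open>Q\<close> is the correction to \<open>s\<close> in Nakayama's lemma.\<close>
  have "s \<otimes> z \<ominus> (d \<otimes> z) \<otimes> z = z \<otimes> s \<ominus> d \<otimes> (z \<otimes> z)" using rd(2) sc zc by algebra
  also have "\<dots> = r \<otimes> x" unfolding rd(3) using rd(1,2) zc xc by algebra
  finally have "s \<otimes> z \<ominus> (d \<otimes> z) \<otimes> z \<in> PIdl x" using rd(1) by (auto simp: PIdl_iff)
  then show "z \<in> sat Q (PIdl x)"
    using sat_nakayama[OF Q px zc _ ideal_mult[OF QI z rd(2)]] s(2) sc by blast
qed

section \<open>Locally idempotent primes\<close>

lemma idempotent_subset_sat_power: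
  assumes Q: "primeideal Q R" and QQ: "Q \<subseteq> sat Q (Q \<cdot> Q)"
  shows "Q \<subseteq> sat Q (Q [^]\<^bsub>ideals_set R\<^esub> (n::nat))"
proof (induction n)
  note QI = primeideal_ideal[OF Q]
  case 0
  show ?case using sat_supset[OF Q oneideal] ideal_subset[OF QI] unfolding ideal_power_0 by blast
next
  note QI = primeideal_ideal[OF Q]
  case (Suc n)
  note pw = ideal_power_ideal[OF QI, of n]
  have "Q \<cdot> Q \<subseteq> sat Q ((Q [^]\<^bsub>ideals_set R\<^esub> n) \<cdot> Q)"
    by (rule sat_prod_mono[OF Q QI QI pw QI Suc sat_supset[OF Q QI]])
  then show ?case
    unfolding ideal_power_Suc using sat_subset[OF Q ideal_prod_is_ideal[OF pw QI]] QQ by blast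
qed

text \<open>Modulo \<open>P\<close>, the factor \<open>A\<close> of the principal ideal of \<open>y\<close> is invertible, hence locally principal.\<close>

lemma prime_factor_sat_principal:
  assumes Q: "primeideal Q R" and P: "primeideal P R" "P \<subseteq> Q" and y: "y \<in> carrier R" "y \<notin> P"
    and A: "ideal A R" and B: "ideal B R" and AB: "PIdl y <+> P = A \<cdot> B"
  obtains a where "a \<in> A" "A \<subseteq> sat Q (PIdl a <+> P)"
proof -
  note PI = primeideal_ideal[OF P(1)]
  have "y \<notin> sat Q P" using sat_prime[OF Q P] y(2) by simp
  then obtain a b c k where a: "a \<in> A" and b: "b \<in> B" and c: "c \<in> carrier R - Q" and k: "k \<in> P"
    and ab: "a \<otimes> b = c \<otimes> y \<oplus> k"
    by (rule principal_factorization_cofactor[OF Q PI y(1) _ AB])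
  have car: "a \<in> carrier R" "b \<in> carrier R" "c \<in> carrier R" "k \<in> carrier R"
    using ideal.Icarr[OF A a] ideal.Icarr[OF B b] ideal.Icarr[OF PI k] c by auto
  have bP: "b \<notin> P"
  proof
    assume "b \<in> P"
    then have "c \<otimes> y \<oplus> k \<in> P" unfolding ab[symmetric] by (rule ideal_mult[OF PI _ car(1)])
    then have "c \<otimes> y \<in> P" using ideal_cancel_add[OF PI _ k] car y by simp
    then show False using primeideal.I_prime[OF P(1) car(3) y(1)] y(2) c P(2) by blast
  qed
  \<comment> \<open>Modulo \<open>P\<close>, \<open>i b = r y\<close> and \<open>a b = c y\<close>.
    So \<open>(c i - r a) b\<close> is in \<open>P\<close>, and \<open>b\<close> outside
    \<open>P\<close> can be cancelled.\<close>
  have "A \<subseteq> sat Q (PIdl a <+> P)"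
  proof
    fix i assume i: "i \<in> A"
    note ic = ideal.Icarr[OF A i]
    have "i \<otimes> b \<in> PIdl y <+> P" unfolding AB using i b by (rule ideal_prod.prod)
    then obtain r l where r: "r \<in> carrier R" and l: "l \<in> P" and ib: "i \<otimes> b = r \<otimes> y \<oplus> l"
      by (auto simp: ideal_add_iff PIdl_iff)
    note lc = ideal.Icarr[OF PI l]
    have "(c \<otimes> i \<ominus> r \<otimes> a) \<otimes> b = c \<otimes> (i \<otimes> b) \<ominus> r \<otimes> (a \<otimes> b)" using car ic r by algebra
    also have "\<dots> = c \<otimes> l \<ominus> r \<otimes> k" unfolding ab ib using car lc r y(1) by algebra
    finally have "(c \<otimes> i \<ominus> r \<otimes> a) \<otimes> b \<in> P"
      using ideal_minus[OF PI ideal_mult[OF PI l car(3)] ideal_mult[OF PI k r]] by simp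
    then have d: "c \<otimes> i \<ominus> r \<otimes> a \<in> P"
      using primeideal.I_prime[OF P(1), of "c \<otimes> i \<ominus> r \<otimes> a" b] bP car ic r by simp
    have "c \<otimes> i = r \<otimes> a \<oplus> (c \<otimes> i \<ominus> r \<otimes> a)" using car ic r by algebra
    moreover have "r \<otimes> a \<in> PIdl a" using r by (auto simp: PIdl_iff)
    ultimately have "c \<otimes> i \<in> PIdl a <+> P" using d unfolding ideal_add_iff by metis
    then show "i \<in> sat Q (PIdl a <+> P)" using c ic by (rule satI)
  qed
  then show thesis using a that by blast
qed

text \<open>A prime \<open>P\<close> strictly below \<open>Q\<close> yields a prime \<open>A\<close>
  strictly above \<open>P\<close> and inside \<open>Q\<close> that is \<open>(a) + P\<close>
  locally, with \<open>a\<close> outside \<open>P\<close>. If \<open>A = Q\<close>, discarding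
  \<open>a\<close> puts \<open>Q\<close> inside \<open>P\<close>. Otherwise a prime
  \<open>Q'\<close> minimal over \<open>(z) + A\<close>, with \<open>z\<close> outside
  \<open>A\<close>, is examined; whether or not it is locally idempotent, \<open>a\<close> is forced
  into \<open>P\<close>.\<close>

lemma idempotent_prime_minimal:
  assumes PP: "\<And>I. ideal I R \<Longrightarrow> I \<in> prime_products R"
    and Q: "primeideal Q R" "Q \<subseteq> sat Q (Q \<cdot> Q)" and P: "primeideal P R" "P \<subseteq> Q"
  shows "P = Q"
proof (rule ccontr)
  assume "P \<noteq> Q"
  then obtain y where y: "y \<in> Q" "y \<notin> P" using P(2) by blast
  note QI = primeideal_ideal[OF Q(1)] and PI = primeideal_ideal[OF P(1)]
  note yc = ideal.Icarr[OF QI y(1)]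
  have I: "ideal (PIdl y <+> P) R" by (intro add_ideals cgenideal_ideal yc PI)
  have "PIdl y <+> P \<subseteq> Q" by (intro ideal_add_least QI cgenideal_minimal[OF QI] y(1) P(2))
  then obtain A B where A: "primeideal A R" "A \<subseteq> Q" and B: "B \<in> prime_products R"
    and AB: "PIdl y <+> P = A \<cdot> B"
    by (rule prime_products_factor[OF PP[OF I] Q(1)])
  note AI = primeideal_ideal[OF A(1)] and BI = prime_products_ideal[OF B]
  have sub: "PIdl y <+> P \<subseteq> A" unfolding AB using ideal_prod_inter[OF AI BI] by blast
  have PA: "P \<subseteq> A" and yA: "y \<in> A"
    using ideal_add_supset[OF cgenideal_ideal[OF yc] PI] cgenideal_self[OF yc] sub by auto
  obtain a where a: "a \<in> A" "A \<subseteq> sat Q (PIdl a <+> P)"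
    by (rule prime_factor_sat_principal[OF Q(1) P yc y(2) AI BI AB])
  note ac = ideal.Icarr[OF AI a(1)]
  have aP: "a \<notin> P"
  proof
    assume "a \<in> P"
    then have "PIdl a <+> P \<subseteq> P" by (intro ideal_add_least PI cgenideal_minimal[OF PI]) auto
    then have "sat Q (PIdl a <+> P) \<subseteq> sat Q P" by (rule sat_mono)
    then show False using sat_prime[OF Q(1) P] a(2) yA y(2) by blast
  qed
  show False
  proof (cases "A = Q")
    case True
    have "Q \<subseteq> sat Q P"
      using sat_nakayama_idempotent[OF Q PI, of a] a True by blast
    then show False using sat_prime[OF Q(1) P] y by blast
  next
    case False
    then obtain z where z: "z \<in> Q" "z \<notin> A" using A(2) by blast
    note zc = ideal.Icarr[OF QI z(1)]
    let ?I = "PIdl z <+> A"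
    have I: "ideal ?I R" by (intro add_ideals cgenideal_ideal zc AI)
    have "?I \<subseteq> Q" by (intro ideal_add_least QI cgenideal_minimal[OF QI] z(1) A(2))
    then obtain Q' where Q': "primeideal Q' R" "?I \<subseteq> Q'" "Q' \<subseteq> Q"
      and min: "\<And>P'. primeideal P' R \<Longrightarrow> ?I \<subseteq> P' \<Longrightarrow> P' \<subseteq> Q' \<Longrightarrow> P' = Q'"
      by (rule prime_products_minimal_prime[OF PP[OF I] Q(1)]) blast
    note QI' = primeideal_ideal[OF Q'(1)]
    have zA': "z \<in> Q'" "A \<subseteq> Q'"
      using ideal_add_supset[OF cgenideal_ideal[OF zc] AI] cgenideal_self[OF zc] Q'(2) by auto
    have PQ': "P \<subseteq> Q'" using PA zA'(2) by blast
    have aQ': "a \<in> Q'" using a(1) zA'(2) by blast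
    \<comment> \<open>The smaller prime \<open>Q'\<close> allows more denominators, so
      \<open>a\<close> still generates \<open>A\<close> modulo \<open>P\<close> locally at
      \<open>Q'\<close>.\<close>
    have "sat Q (PIdl a <+> P) \<subseteq> sat Q' (PIdl a <+> P)"
      using Q'(3) by (auto simp: saturation_def)
    then have A_le: "A \<subseteq> sat Q' (PIdl a <+> P)" using a(2) by blast
    show False
    proof (cases "Q' \<subseteq> sat Q' (Q' \<cdot> Q')")
      case True
      \<comment> \<open>By minimality of \<open>Q'\<close>, \<open>?I\<close> is locally a power of
        \<open>Q'\<close>, which by idempotence contains \<open>Q'\<close> for every
        \<open>n\<close>. So \<open>Q'\<close> is locally \<open>(z) + (a) + P\<close>, and
        discarding \<open>z\<close> and then \<open>a\<close> puts it inside
        \<open>P\<close>.\<close>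
      obtain n :: nat where "sat Q' ?I = sat Q' (Q' [^]\<^bsub>ideals_set R\<^esub> n)"
        by (rule prime_products_sat_power[OF PP[OF I] Q'(1) min])
      then have Q'_le: "Q' \<subseteq> sat Q' ?I" using idempotent_subset_sat_power[OF Q'(1) True] by simp
      have K: "ideal (PIdl a <+> P) R" by (intro add_ideals cgenideal_ideal ac PI)
      note zK = ideal_add_supset[OF cgenideal_ideal[OF zc] K]
      note zK_ideal = add_ideals[OF cgenideal_ideal[OF zc] K]
      have "?I \<subseteq> sat Q' (PIdl z <+> (PIdl a <+> P))"
      proof (rule ideal_add_least[OF sat_ideal[OF Q'(1) zK_ideal]])
        show "PIdl z \<subseteq> sat Q' (PIdl z <+> (PIdl a <+> P))"
          using zK(1) sat_supset[OF Q'(1) zK_ideal] by blast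
        show "A \<subseteq> sat Q' (PIdl z <+> (PIdl a <+> P))"
          using A_le sat_mono[OF zK(2)] by blast
      qed
      then have "Q' \<subseteq> sat Q' (PIdl z <+> (PIdl a <+> P))"
        using Q'_le sat_subset[OF Q'(1) zK_ideal] by blast
      then have "Q' \<subseteq> sat Q' (PIdl a <+> P)"
        by (rule sat_nakayama_idempotent[OF Q'(1) True K zA'(1)])
      then have "Q' \<subseteq> sat Q' P"
        by (rule sat_nakayama_idempotent[OF Q'(1) True PI aQ'])
      then show False using sat_prime[OF Q'(1) P(1) PQ'] aP aQ' by blast
    next
      case False
      then obtain x where x: "x \<in> Q'" "x \<notin> sat Q' (Q' \<cdot> Q')" by blast
      note xc = ideal.Icarr[OF QI' x(1)]
      \<comment> \<open>Here \<open>x\<close> generates \<open>Q'\<close> locally and lies outside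
        \<open>A\<close>. Locally \<open>a = r x\<close>, so \<open>r\<close> is in \<open>A\<close>
        and \<open>r = d a + k\<close> with \<open>k\<close> in \<open>P\<close>. Then
        \<open>a = d x a + k x\<close>, and Nakayama's lemma puts \<open>a\<close> into
        \<open>P\<close>.\<close>
      have Q'_le: "Q' \<subseteq> sat Q' (PIdl x)" by (rule sat_principal_of_notin_square[OF PP Q'(1) x])
      have xA: "x \<notin> A"
      proof
        assume "x \<in> A"
        then have "PIdl x \<subseteq> A" by (rule cgenideal_minimal[OF AI])
        then have "Q' \<subseteq> sat Q' A" using sat_mono Q'_le by blast
        then show False using sat_prime[OF Q'(1) A(1) zA'(2)] z(2) zA'(1) by blast
      qed
      have "a \<in> sat Q' (PIdl x)" using aQ' Q'_le by blast
      then obtain s r where s: "s \<in> carrier R - Q'" and r: "r \<in> carrier R" and sa: "s \<otimes> a = r \<otimes> x"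
        by (auto simp: sat_iff PIdl_iff)
      have sc: "s \<in> carrier R" using s by blast
      have "r \<otimes> x \<in> A" unfolding sa[symmetric] by (rule ideal_mult[OF AI a(1) sc])
      then have "r \<in> A" using primeideal.I_prime[OF A(1) r xc] xA by blast
      then have "r \<in> sat Q' (PIdl a <+> P)" using A_le by blast
      then obtain t d k where t: "t \<in> carrier R - Q'" and d: "d \<in> carrier R" and k: "k \<in> P"
        and tr: "t \<otimes> r = d \<otimes> a \<oplus> k"
        by (auto simp: sat_iff PIdl_iff ideal_add_iff)
      note kc = ideal.Icarr[OF PI k]
      have tc: "t \<in> carrier R" using t by blast
      have "(t \<otimes> s) \<otimes> a = t \<otimes> (s \<otimes> a)" using tc sc ac by (simp add: m_assoc)
      also have "\<dots> = (t \<otimes> r) \<otimes> x" unfolding sa using tc r xc by (simp add: m_assoc)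
      finally have ts: "(t \<otimes> s) \<otimes> a = (d \<otimes> a \<oplus> k) \<otimes> x" unfolding tr .
      have "(t \<otimes> s) \<otimes> a \<ominus> (d \<otimes> x) \<otimes> a = k \<otimes> x" unfolding ts using d ac kc xc by algebra
      then have "a \<in> sat Q' P"
        using sat_nakayama[OF Q'(1) PI ac primeideal_mult_notin[OF Q'(1) t s] ideal_mult[OF QI' x(1) d]]
          ideal_mult_r[OF PI k xc] by simp
      then show False using sat_prime[OF Q'(1) P(1) PQ'] aP by blast
    qed
  qed
qed

lemma prime_locally_principal:
  assumes PP: "\<And>I. ideal I R \<Longrightarrow> I \<in> prime_products R" and Q: "primeideal Q R"
  shows "\<exists>x\<in>Q. Q \<subseteq> sat Q (PIdl x)"
proof (cases "Q \<subseteq> sat Q (Q \<cdot> Q)")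
  case True
  obtain n :: nat where "sat Q {\<zero>} = sat Q (Q [^]\<^bsub>ideals_set R\<^esub> n)"
    by (rule prime_products_sat_power[OF PP[OF zeroideal] Q]) (use idempotent_prime_minimal[OF PP Q True] in blast)+
  then have "Q \<subseteq> sat Q {\<zero>}" using idempotent_subset_sat_power[OF Q True] by simp
  then have "Q \<subseteq> sat Q (PIdl \<zero>)"
    using sat_mono[of "{\<zero>}" "PIdl \<zero>" Q] ideal_zero[OF cgenideal_ideal[OF zero_closed]] by blast
  then show ?thesis using ideal_zero[OF primeideal_ideal[OF Q]] by blast
next
  case False
  then show ?thesis using sat_principal_of_notin_square[OF PP Q] by blast
qed

section \<open>Recovering ideals from their local powers\<close>

lemma ideal_power_1: assumes "ideal I R" shows "I [^]\<^bsub>ideals_set R\<^esub> (1::nat) = I"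
  using ideal_power_Suc[of I 0] ideal_prod_commute[OF oneideal assms] ideal_prod_one[OF assms]
  unfolding ideal_power_0 by simp

lemma sat_zero_subset: "ideal I R \<Longrightarrow> sat Q {\<zero>} \<subseteq> sat Q I"
  using ideal_zero by (intro sat_mono) auto

context
  assumes dichotomy: "\<And>M a. maximalideal M R \<Longrightarrow> a \<in> carrier R \<Longrightarrow>
    a \<in> sat M {\<zero>} \<or> (\<exists>n::nat. sat M (PIdl a) = sat M (M [^]\<^bsub>ideals_set R\<^esub> n))"
begin

text \<open>The least exponent attained by a principal ideal inside \<open>I\<close> belongs to the
  largest power of \<open>M\<close>, and an element attaining it generates \<open>I\<close>
  locally.\<close>

lemma sat_ideal_dichotomy:
  assumes M: "maximalideal M R" and I: "ideal I R"
  shows "sat M I = sat M {\<zero>} \<or> (\<exists>n::nat. sat M I = sat M (M [^]\<^bsub>ideals_set R\<^esub> n))"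
proof (cases "I \<subseteq> sat M {\<zero>}")
  case True
  then have "sat M I \<subseteq> sat M {\<zero>}" by (rule sat_subset[OF maximalideal_prime[OF M] zeroideal])
  then show ?thesis using sat_zero_subset[OF I] by blast
next
  case False
  note M' = maximalideal_prime[OF M]
  note pw = ideal_power_ideal[OF primeideal_ideal[OF M']]
  note Ic = ideal.Icarr[OF I]
  let ?A = "\<lambda>n::nat. \<exists>a\<in>I. sat M (PIdl a) = sat M (M [^]\<^bsub>ideals_set R\<^esub> n)"
  obtain a0 where "a0 \<in> I" "a0 \<notin> sat M {\<zero>}" using False by blast
  then have "\<exists>n. ?A n" using dichotomy[OF M Ic] by metis
  then have "?A (LEAST n. ?A n)" by (rule LeastI_ex)
  then obtain a where a: "a \<in> I" "sat M (PIdl a) = sat M (M [^]\<^bsub>ideals_set R\<^esub> (LEAST n. ?A n))"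
    by blast
  define n where "n = (LEAST n. ?A n)"
  note a = a[folded n_def]
  have "I \<subseteq> sat M (M [^]\<^bsub>ideals_set R\<^esub> n)"
  proof
    fix b assume b: "b \<in> I"
    consider "b \<in> sat M {\<zero>}" | m :: nat where "sat M (PIdl b) = sat M (M [^]\<^bsub>ideals_set R\<^esub> m)"
      using dichotomy[OF M Ic[OF b]] by blast
    then show "b \<in> sat M (M [^]\<^bsub>ideals_set R\<^esub> n)"
    proof cases
      case 1
      then show ?thesis using sat_zero_subset[OF pw] by blast
    next
      case (2 m)
      then have "n \<le> m" unfolding n_def using b by (intro Least_le) blast
      then have "sat M (PIdl b) \<subseteq> sat M (M [^]\<^bsub>ideals_set R\<^esub> n)"
        unfolding 2 using ideal_power_decreasing[OF primeideal_ideal[OF M']] by (intro sat_mono) blast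
      then show ?thesis
        using sat_supset[OF M' cgenideal_ideal] cgenideal_self Ic[OF b] by blast
    qed
  qed
  then have "sat M I \<subseteq> sat M (M [^]\<^bsub>ideals_set R\<^esub> n)" by (rule sat_subset[OF M' pw])
  moreover have "sat M (M [^]\<^bsub>ideals_set R\<^esub> n) \<subseteq> sat M I"
    unfolding a(2)[symmetric] by (intro sat_mono cgenideal_minimal[OF I a(1)])
  ultimately show ?thesis by blast
qed

text \<open>A prime that is locally a power of \<open>M\<close> contains \<open>M\<close>. The other
  candidate \<open>sat M {\<zero>}\<close> is the kernel of the localization map.\<close>

lemma prime_below_maximal:
  assumes M: "maximalideal M R" and P: "primeideal P R" "P \<subseteq> M"
  shows "P = M \<or> P = sat M {\<zero>}"
proof -
  note M' = maximalideal_prime[OF M]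
  note MI = primeideal_ideal[OF M']
  have sP: "sat M P = P" by (rule sat_prime[OF M' P])
  consider "P = sat M {\<zero>}" | n :: nat where "P = sat M (M [^]\<^bsub>ideals_set R\<^esub> n)"
    using sat_ideal_dichotomy[OF M primeideal_ideal[OF P(1)]] unfolding sP by blast
  then show ?thesis
  proof cases
    case (2 n)
    then have "M \<subseteq> P"
      using prime_of_ideal_power_subset[OF P(1) MI, of n] sat_supset[OF M' ideal_power_ideal[OF MI, of n]]
      by simp
    then show ?thesis using P(2) by blast
  qed simp
qed

text \<open>Prime factors of principal ideals give finitely many candidates. A minimal prime
  \<open>P\<close> over \<open>I\<close> contains a factor \<open>P0\<close> of the zero ideal. If
  \<open>P0\<close> differs from \<open>P\<close>, it misses an element of \<open>I\<close>, and
  \<open>P\<close> is a factor of the ideal generated by that element.\<close>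

lemma finite_minimal_primes:
  assumes PP: "\<And>a. a \<in> carrier R \<Longrightarrow> PIdl a \<in> prime_products R" and I: "ideal I R"
  shows "finite {P. primeideal P R \<and> I \<subseteq> P \<and> (\<forall>P'. primeideal P' R \<longrightarrow> I \<subseteq> P' \<longrightarrow> P' \<subseteq> P \<longrightarrow> P' = P)}"
    (is "finite ?F")
proof -
  have "\<exists>F. finite F \<and> (\<forall>P\<in>F. primeideal P R \<and> a \<in> P) \<and>
      (\<forall>Q. primeideal Q R \<and> a \<in> Q \<longrightarrow> (\<exists>P\<in>F. P \<subseteq> Q))" if a: "a \<in> carrier R" for a
  proof -
    obtain F where F: "finite F" "\<And>P. P \<in> F \<Longrightarrow> primeideal P R \<and> PIdl a \<subseteq> P"
      "\<And>Q. primeideal Q R \<Longrightarrow> PIdl a \<subseteq> Q \<Longrightarrow> \<exists>P\<in>F. P \<subseteq> Q"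
      by (rule prime_products_finite_factors[OF PP[OF a]]) simp
    have "a \<in> P" if "P \<in> F" for P using F(2)[OF that] cgenideal_self[OF a] by blast
    moreover have "\<exists>P\<in>F. P \<subseteq> Q" if "primeideal Q R" "a \<in> Q" for Q
      using F(3)[OF that(1)] cgenideal_minimal[OF primeideal_ideal that(2)] that(1) by simp
    ultimately show ?thesis using F(1,2) by (intro exI[of _ F]) simp
  qed
  then have "\<forall>a\<in>carrier R. \<exists>F. finite F \<and> (\<forall>P\<in>F. primeideal P R \<and> a \<in> P) \<and>
      (\<forall>Q. primeideal Q R \<and> a \<in> Q \<longrightarrow> (\<exists>P\<in>F. P \<subseteq> Q))" by blast
  then obtain f where "\<forall>a\<in>carrier R. finite (f a) \<and> (\<forall>P\<in>f a. primeideal P R \<and> a \<in> P) \<and>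
      (\<forall>Q. primeideal Q R \<and> a \<in> Q \<longrightarrow> (\<exists>P\<in>f a. P \<subseteq> Q))"
    by (rule bchoice[THEN exE])
  then have fin: "\<And>a. a \<in> carrier R \<Longrightarrow> finite (f a)"
    and f_prime: "\<And>a P. a \<in> carrier R \<Longrightarrow> P \<in> f a \<Longrightarrow> primeideal P R"
    and f_mem: "\<And>a P. a \<in> carrier R \<Longrightarrow> P \<in> f a \<Longrightarrow> a \<in> P"
    and f_le: "\<And>a Q. a \<in> carrier R \<Longrightarrow> primeideal Q R \<Longrightarrow> a \<in> Q \<Longrightarrow> \<exists>P\<in>f a. P \<subseteq> Q"
    by simp_all
  \<comment> \<open>A witness for \<open>\<not> I \<subseteq> P\<close>; the value is arbitrary when
    \<open>I\<close> lies inside \<open>P\<close>.\<close>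
  define g where "g P = (SOME a. a \<in> I - P)" for P
  have g: "g P \<in> I" "g P \<notin> P" if "\<not> I \<subseteq> P" for P
    using someI_ex[of "\<lambda>a. a \<in> I - P"] that unfolding g_def by auto
  have "?F \<subseteq> f \<zero> \<union> (\<Union>P\<in>{P \<in> f \<zero>. \<not> I \<subseteq> P}. f (g P))"
  proof
    fix P assume "P \<in> ?F"
    then have P: "primeideal P R" "I \<subseteq> P"
      and min: "\<And>P'. primeideal P' R \<Longrightarrow> I \<subseteq> P' \<Longrightarrow> P' \<subseteq> P \<Longrightarrow> P' = P" by auto
    note PI = primeideal_ideal[OF P(1)]
    obtain P0 where P0: "P0 \<in> f \<zero>" "P0 \<subseteq> P"
      using f_le[OF zero_closed P(1) ideal_zero[OF PI]] by blast
    note P0p = f_prime[OF zero_closed P0(1)]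
    show "P \<in> f \<zero> \<union> (\<Union>P\<in>{P \<in> f \<zero>. \<not> I \<subseteq> P}. f (g P))"
    proof (cases "P0 = P")
      case True
      then show ?thesis using P0 by blast
    next
      case False
      then have nI: "\<not> I \<subseteq> P0" using min[OF P0p _ P0(2)] by blast
      note gc = ideal.Icarr[OF I g(1)[OF nI]]
      obtain P1 where P1: "P1 \<in> f (g P0)" "P1 \<subseteq> P"
        using f_le[OF gc P(1)] g(1)[OF nI] P(2) by blast
      note P1p = f_prime[OF gc P1(1)]
      obtain M where M: "maximalideal M R" "P \<subseteq> M"
        using exists_maximalideal[OF PI] primeideal.I_notcarr[OF P(1)] by metis
      have below: "X = M \<or> X = sat M {\<zero>}" if "primeideal X R" "X \<subseteq> P" for X
        using prime_below_maximal[OF M(1) that(1)] that(2) M(2) by blast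
      \<comment> \<open>\<open>P1\<close> contains \<open>g P0\<close> while \<open>P0\<close> does
        not. The two primes possible below \<open>M\<close> are already taken by \<open>P0\<close>
        and \<open>P\<close>, so \<open>P1\<close> is \<open>P\<close>.\<close>
      have "P1 \<noteq> P0" using f_mem[OF gc P1(1)] g(2)[OF nI] by blast
      then have "P1 = P"
        using below[OF P0p P0(2)] below[OF P1p P1(2)] below[OF P(1)] False P0(2) P1(2) by blast
      then show ?thesis using P1(1) P0(1) nI by blast
    qed
  qed
  moreover have "finite (f \<zero> \<union> (\<Union>P\<in>{P \<in> f \<zero>. \<not> I \<subseteq> P}. f (g P)))"
    using fin[OF zero_closed] fin[OF ideal.Icarr[OF I g(1)]] by auto
  ultimately show ?thesis by (rule finite_subset)
qed

end

text \<open>The product of all \<open>P [^] e P\<close> over \<open>F\<close> works: the powers of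
  primes not contained in \<open>M\<close> disappear locally, so that no factor or just one survives
  in the two situations.\<close>

lemma exists_sat_prime_power_product:
  assumes "finite F" "\<And>P. P \<in> F \<Longrightarrow> primeideal P R"
  shows "\<exists>J\<in>prime_products R. \<forall>M. primeideal M R \<longrightarrow>
    ((\<forall>P\<in>F. \<not> P \<subseteq> M) \<longrightarrow> sat M J = carrier R) \<and>
    (\<forall>P\<in>F. P \<subseteq> M \<longrightarrow> (\<forall>P'\<in>F. P' \<subseteq> M \<longrightarrow> P' = P) \<longrightarrow>
      sat M J = sat M (P [^]\<^bsub>ideals_set R\<^esub> (e P :: nat)))"
  using assms
proof (induction F)
  case empty
  have "sat M (carrier R) = carrier R" if "primeideal M R" for M
    using sat_supset[OF that oneideal] by (auto simp: saturation_def)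
  then show ?case using ideal_products.one[of R] by (intro bexI[of _ "carrier R"]) auto
next
  case (insert P F)
  obtain J where J: "J \<in> prime_products R" and all: "\<forall>M. primeideal M R \<longrightarrow>
    ((\<forall>P\<in>F. \<not> P \<subseteq> M) \<longrightarrow> sat M J = carrier R) \<and>
    (\<forall>P\<in>F. P \<subseteq> M \<longrightarrow> (\<forall>P'\<in>F. P' \<subseteq> M \<longrightarrow> P' = P) \<longrightarrow>
      sat M J = sat M (P [^]\<^bsub>ideals_set R\<^esub> e P))"
    by (rule bexE[OF insert.IH[OF insert.prems[OF insertI2]]])
  note none = all[THEN spec, THEN mp, THEN conjunct1, THEN mp]
    and one = all[THEN spec, THEN mp, THEN conjunct2, THEN bspec, THEN mp, THEN mp]
  have P: "primeideal P R" using insert.prems by blast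
  note PI = primeideal_ideal[OF P] and JI = prime_products_ideal[OF J]
  let ?P = "P [^]\<^bsub>ideals_set R\<^esub> e P"
  have pI: "ideal ?P R" by (rule ideal_power_ideal[OF PI])
  have drop: "sat M (J \<cdot> ?P) = sat M J" if "primeideal M R" "\<not> P \<subseteq> M" for M
    using sat_prod_drop[OF that(1) JI pI] prime_of_ideal_power_subset[OF that(1) PI] that(2) by blast
  have unit: "sat M (J \<cdot> ?P) = sat M ?P" if M: "primeideal M R" and "sat M J = carrier R" for M
  proof -
    have "sat M J = sat M (carrier R)"
      using that sat_supset[OF M oneideal] by (auto simp: saturation_def)
    then have "sat M (J \<cdot> ?P) = sat M (carrier R \<cdot> ?P)"
      by (rule sat_prod_cong[OF M JI pI oneideal pI _ refl])
    then show ?thesis using ideal_prod_commute[OF oneideal pI] ideal_prod_one[OF pI] by simp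
  qed
  show ?case
  proof (intro bexI[of _ "J \<cdot> ?P"] allI impI conjI ballI)
    show "J \<cdot> ?P \<in> prime_products R"
      by (intro prime_products_mult J prime_products_power prime_in_prime_products P)
    fix M assume M: "primeideal M R"
    show "sat M (J \<cdot> ?P) = carrier R" if "\<forall>Q\<in>insert P F. \<not> Q \<subseteq> M"
      using drop[OF M] none[OF M] that by simp
    fix Q assume Q: "Q \<in> insert P F" "Q \<subseteq> M" "\<forall>P'\<in>insert P F. P' \<subseteq> M \<longrightarrow> P' = Q"
    show "sat M (J \<cdot> ?P) = sat M (Q [^]\<^bsub>ideals_set R\<^esub> e Q)"
    proof (cases "Q = P")
      case True
      then have "\<forall>P'\<in>F. \<not> P' \<subseteq> M" using Q(3) insert.hyps(2) by blast
      then show ?thesis using unit[OF M none[OF M]] True by simp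
    next
      case False
      then have "\<not> P \<subseteq> M" using Q(3) by blast
      moreover have "Q \<in> F" "\<forall>P'\<in>F. P' \<subseteq> M \<longrightarrow> P' = Q" using Q(1,3) False by blast+
      ultimately show ?thesis using drop[OF M] one[OF M _ Q(2)] by metis
    qed
  qed
qed

lemma ideal_in_prime_products:
  assumes dichotomy: "\<And>M a. maximalideal M R \<Longrightarrow> a \<in> carrier R \<Longrightarrow>
      a \<in> sat M {\<zero>} \<or> (\<exists>n::nat. sat M (PIdl a) = sat M (M [^]\<^bsub>ideals_set R\<^esub> n))"
    and PP: "\<And>a. a \<in> carrier R \<Longrightarrow> PIdl a \<in> prime_products R"
    and I: "ideal I R"
  shows "I \<in> prime_products R"
proof -
  define F where "F = {P. primeideal P R \<and> I \<subseteq> P \<and>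
    (\<forall>P'. primeideal P' R \<longrightarrow> I \<subseteq> P' \<longrightarrow> P' \<subseteq> P \<longrightarrow> P' = P)}"
  have F: "primeideal P R" "I \<subseteq> P" "\<And>P'. primeideal P' R \<Longrightarrow> I \<subseteq> P' \<Longrightarrow> P' \<subseteq> P \<Longrightarrow> P' = P"
    if "P \<in> F" for P
    using that unfolding F_def by auto
  have finF: "finite F"
    unfolding F_def by (rule finite_minimal_primes[OF dichotomy PP I])
  have below: "P = M \<or> P = sat M {\<zero>}" if "maximalideal M R" "primeideal P R" "P \<subseteq> M" for M P
    by (rule prime_below_maximal[OF dichotomy]) (use that in auto)
  have ideal_dichotomy: "sat M I = sat M {\<zero>} \<or> (\<exists>n::nat. sat M I = sat M (M [^]\<^bsub>ideals_set R\<^esub> n))"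
    if "maximalideal M R" for M
    by (rule sat_ideal_dichotomy[OF dichotomy]) (use that I in auto)
  \<comment> \<open>By \<open>below\<close>, two primes of \<open>F\<close> inside \<open>M\<close>
    are comparable, and comparable minimal primes over \<open>I\<close> coincide.\<close>
  have unique: "P = P'" if "maximalideal M R" "P \<in> F" "P' \<in> F" "P \<subseteq> M" "P' \<subseteq> M" for M P P'
  proof -
    have "P \<subseteq> P' \<or> P' \<subseteq> P"
      using below[OF that(1) F(1)[OF that(2)] that(4)] below[OF that(1) F(1)[OF that(3)] that(5)] that(4,5)
      by blast
    then show ?thesis
      using F(3)[OF that(2) F(1,2)[OF that(3)]] F(3)[OF that(3) F(1,2)[OF that(2)]] by blast
  qed
  \<comment> \<open>A prime strictly below \<open>M\<close> is \<open>sat M {\<zero>}\<close>, with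
    no smaller prime inside it. If no such prime contains \<open>I\<close>, then \<open>M\<close>
    itself is minimal over \<open>I\<close>.\<close>
  have cover: "\<exists>P\<in>F. P \<subseteq> M" if M: "maximalideal M R" "I \<subseteq> M" for M
  proof (cases "\<exists>P. primeideal P R \<and> I \<subseteq> P \<and> P \<subseteq> M \<and> P \<noteq> M")
    case True
    then obtain P where P: "primeideal P R" "I \<subseteq> P" "P \<subseteq> M" "P \<noteq> M" by blast
    have "P' = P" if P': "primeideal P' R" "P' \<subseteq> P" for P'
      using below[OF M(1) P'(1)] below[OF M(1) P(1,3)] P' P(3,4) by blast
    then show ?thesis using P unfolding F_def by blast
  next
    case False
    then show ?thesis using M maximalideal_prime[OF M(1)] unfolding F_def by blast
  qed
  have zero: "{\<zero>} \<in> prime_products R"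
    using PP[OF zero_closed] cgenideal_eq_genideal[OF zero_closed] genideal_zero by simp
  \<comment> \<open>One exponent must serve every maximal \<open>M\<close> above \<open>P\<close>.
    If \<open>P\<close> is maximal, the only such \<open>M\<close> is \<open>P\<close>. Otherwise
    \<open>P\<close> is \<open>sat M {\<zero>}\<close> at each of them, so \<open>I\<close> and
    \<open>P\<close> agree locally and exponent 1 works.\<close>
  have "\<exists>n::nat. \<forall>M. maximalideal M R \<longrightarrow> P \<subseteq> M \<longrightarrow> sat M I = sat M (P [^]\<^bsub>ideals_set R\<^esub> n)"
    if P: "P \<in> F" for P
  proof (cases "maximalideal P R")
    case True
    have "\<exists>n::nat. sat P I = sat P (P [^]\<^bsub>ideals_set R\<^esub> n)"
    proof (cases "sat P I = sat P {\<zero>}")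
      case zero_sat: True
      \<comment> \<open>When \<open>I\<close> is locally zero at \<open>P\<close>, every prime
        inside \<open>P\<close> contains \<open>I\<close>. So \<open>P\<close> is a minimal prime of
        \<open>R\<close>, and the zero ideal is locally a power of \<open>P\<close>.\<close>
      have "P' = P" if P': "primeideal P' R" "P' \<subseteq> P" for P'
      proof -
        have "sat P {\<zero>} \<subseteq> P'"
          using sat_zero_subset[OF primeideal_ideal[OF P'(1)], of P] sat_prime[OF F(1)[OF P] P'] by simp
        then have "I \<subseteq> P'" using sat_supset[OF F(1)[OF P] I] zero_sat by simp
        then show ?thesis using F(3)[OF P P'(1)] P'(2) by blast
      qed
      then obtain n :: nat where "sat P {\<zero>} = sat P (P [^]\<^bsub>ideals_set R\<^esub> n)"
        using prime_products_sat_power[OF zero F(1)[OF P]] by metis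
      then show ?thesis using zero_sat by auto
    next
      case False
      then show ?thesis using ideal_dichotomy[OF True] by blast
    qed
    moreover have "M = P" if "maximalideal M R" "P \<subseteq> M" for M
      using maximal_eq[OF True maximalideal_prime[OF that(1)] that(2)] .
    ultimately show ?thesis by metis
  next
    case False
    note PI = primeideal_ideal[OF F(1)[OF P]]
    have "sat M I = sat M (P [^]\<^bsub>ideals_set R\<^esub> (1::nat))" if M: "maximalideal M R" "P \<subseteq> M" for M
    proof -
      note M' = maximalideal_prime[OF M(1)]
      have sP: "sat M P = P" by (rule sat_prime[OF M' F(1)[OF P] M(2)])
      have "P = sat M {\<zero>}" using below[OF M(1) F(1)[OF P] M(2)] False M(1) by blast
      then have "P \<subseteq> sat M I" using sat_zero_subset[OF I] by blast
      moreover have "sat M I \<subseteq> P" using sat_mono[OF F(2)[OF P], of M] sP by simp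
      ultimately show ?thesis unfolding ideal_power_1[OF PI] sP by blast
    qed
    then show ?thesis by blast
  qed
  then obtain e :: "'a set \<Rightarrow> nat" where e: "\<And>P M. P \<in> F \<Longrightarrow> maximalideal M R \<Longrightarrow> P \<subseteq> M \<Longrightarrow>
      sat M I = sat M (P [^]\<^bsub>ideals_set R\<^esub> e P)"
    by metis
  obtain J where J: "J \<in> prime_products R" and all: "\<forall>M. primeideal M R \<longrightarrow>
    ((\<forall>P\<in>F. \<not> P \<subseteq> M) \<longrightarrow> sat M J = carrier R) \<and>
    (\<forall>P\<in>F. P \<subseteq> M \<longrightarrow> (\<forall>P'\<in>F. P' \<subseteq> M \<longrightarrow> P' = P) \<longrightarrow>
      sat M J = sat M (P [^]\<^bsub>ideals_set R\<^esub> e P))"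
    by (rule bexE[OF exists_sat_prime_power_product[OF finF F(1), of e]])
  note none = all[THEN spec, THEN mp, THEN conjunct1, THEN mp]
    and one = all[THEN spec, THEN mp, THEN conjunct2, THEN bspec, THEN mp, THEN mp]
  note JI = prime_products_ideal[OF J]
  have eq: "sat M I = sat M J" if M: "maximalideal M R" for M
  proof (cases "\<exists>P\<in>F. P \<subseteq> M")
    case True
    then obtain P where P: "P \<in> F" "P \<subseteq> M" by blast
    then have "\<forall>P'\<in>F. P' \<subseteq> M \<longrightarrow> P' = P" using unique[OF M] by blast
    then show ?thesis using e[OF P(1) M P(2)] one[OF maximalideal_prime[OF M] P] by simp
  next
    case False
    then have "\<not> I \<subseteq> M" using cover[OF M] by blast
    then show ?thesis
      using sat_eq_carrier[OF maximalideal_prime[OF M] I] none[OF maximalideal_prime[OF M]] False by simp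
  qed
  have "I \<subseteq> J"
    using subset_if_sat_subset[OF I JI] eq sat_supset[OF maximalideal_prime I] by simp
  moreover have "J \<subseteq> I"
    using subset_if_sat_subset[OF JI I] eq sat_supset[OF maximalideal_prime JI] by simp
  ultimately show ?thesis using J by simp
qed

section \<open>OA-ideals\<close>

lemma primeideal_OA_ideal: assumes P: "primeideal P R" shows "OA_ideal P R"
  unfolding OA_ideal_def proper_ideal_def
proof (intro conjI ballI impI)
  show "ideal P R" by (rule primeideal_ideal[OF P])
  show "P \<noteq> carrier R" using primeideal.I_notcarr[OF P] by blast
  fix a b c assume "a \<in> carrier R - Units R" "b \<in> carrier R - Units R" "c \<in> carrier R - Units R"
    "a \<otimes> b \<otimes> c \<in> P"
  then show "a \<otimes> b \<in> P \<or> c \<in> P" using primeideal.I_prime[OF P, of "a \<otimes> b" c] by simp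
qed

lemma ideal_cancel_unit:
  assumes "ideal I R" "u \<in> Units R" "x \<in> carrier R" "u \<otimes> x \<in> I" shows "x \<in> I"
proof -
  have "inv u \<otimes> (u \<otimes> x) = x"
    using assms(2,3) by (simp add: m_assoc[symmetric] Units_closed)
  then show ?thesis using ideal_mult[OF assms(1,4) Units_inv_closed[OF assms(2)]] by simp
qed

text \<open>Take \<open>a\<close> and \<open>b\<close> outside \<open>I\<close> with
  \<open>a \<otimes> b \<in> I\<close>; both are nonunits. For a nonunit \<open>z\<close>, the
  OA-condition on \<open>z a b\<close> gives \<open>z a\<close> in \<open>I\<close>, since
  \<open>b\<close> is outside. Then \<open>x y a\<close> lies in \<open>I\<close>, and the condition
  gives \<open>x y\<close> in \<open>I\<close>, since \<open>a\<close> is outside.\<close>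

lemma OA_ideal_nonunits_mult:
  assumes I: "OA_ideal I R" "\<not> primeideal I R"
    and xy: "x \<in> carrier R - Units R" "y \<in> carrier R - Units R"
  shows "x \<otimes> y \<in> I"
proof -
  have II: "ideal I R" and Ic: "I \<noteq> carrier R" using I(1) by (auto simp: OA_ideal_def proper_ideal_def)
  have OA: "a \<otimes> b \<in> I \<or> c \<in> I" if "a \<in> carrier R - Units R" "b \<in> carrier R - Units R"
    "c \<in> carrier R - Units R" "a \<otimes> b \<otimes> c \<in> I" for a b c
    using I(1) that unfolding OA_ideal_def by blast
  obtain a b where ab: "a \<in> carrier R" "b \<in> carrier R" "a \<otimes> b \<in> I" "a \<notin> I" "b \<notin> I"
    using I(2) primeidealI[OF II is_cring] Ic by metis
  have "a \<notin> Units R" using ideal_cancel_unit[OF II _ ab(2,3)] ab(5) by blast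
  moreover have "b \<notin> Units R"
    using ideal_cancel_unit[OF II _ ab(1), of b] ab(1-4) m_comm by metis
  ultimately have n: "a \<in> carrier R - Units R" "b \<in> carrier R - Units R" using ab by auto
  have za: "z \<otimes> a \<in> I" if z: "z \<in> carrier R - Units R" for z
  proof -
    have "z \<otimes> a \<otimes> b \<in> I" using ideal_mult[OF II ab(3), of z] z ab(1,2) by (simp add: m_assoc)
    then show ?thesis using OA[OF z n] ab(5) by blast
  qed
  have "x \<otimes> y \<otimes> a \<in> I" using ideal_mult[OF II za[OF xy(2)], of x] xy ab(1) by (simp add: m_assoc)
  then show ?thesis using OA[OF xy n(1)] ab(4) by blast
qed

text \<open>A non-prime OA-ideal \<open>I\<close> forces \<open>R\<close> to be local with \<open>M \<cdot> M \<subseteq> I \<subseteq> M\<close>, and in a chained ring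
  nothing lies strictly between \<open>M \<cdot> M\<close> and \<open>M\<close>.\<close>

lemma OA_ideal_in_prime_products:
  assumes arith: "arithmetical_ring R" and I: "OA_ideal I R"
  shows "I \<in> prime_products R"
proof (cases "primeideal I R")
  case True
  then show ?thesis by (rule prime_in_prime_products)
next
  case False
  note nonunits = OA_ideal_nonunits_mult[OF I False]
  have II: "ideal I R" and Ic: "I \<noteq> carrier R" using I by (auto simp: OA_ideal_def proper_ideal_def)
  obtain M where M: "maximalideal M R" "I \<subseteq> M" using exists_maximalideal[OF II Ic] .
  note M' = maximalideal_prime[OF M(1)]
  note MI = primeideal_ideal[OF M']
  have M_nonunit: "x \<notin> Units R" if "x \<in> M" for x
  proof
    assume "x \<in> Units R"
    then have "\<one> \<in> M" using ideal_cancel_unit[OF MI _ one_closed, of x] that by (simp add: Units_closed)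
    then show False using primeideal_one_notin[OF M'] by blast
  qed
  \<comment> \<open>The square of a nonunit lies in \<open>I\<close> and so in \<open>M\<close>.
    Hence everything outside \<open>M\<close> is a unit, and local multiples are genuine
    multiples.\<close>
  have unit: "x \<in> Units R" if "x \<in> carrier R - M" for x
  proof (rule ccontr)
    assume "x \<notin> Units R"
    then have "x \<otimes> x \<in> M" using nonunits[of x x] that M(2) by blast
    then show False using primeideal_mult_notin[OF M' that that] by blast
  qed
  have MM: "M \<cdot> M \<subseteq> I"
    using nonunits M_nonunit ideal.Icarr[OF MI] by (intro ideal_prod_least[OF II]) auto
  show ?thesis
  proof (cases "I \<subseteq> M \<cdot> M")
    case True
    then have "I = M \<cdot> M" using MM by blast
    then show ?thesis using prime_products_mult prime_in_prime_products[OF M'] by simp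
  next
    case False
    then obtain y where y: "y \<in> I" "y \<notin> M \<cdot> M" by blast
    note yc = ideal.Icarr[OF II y(1)]
    have "w \<in> I" if w: "w \<in> M" for w
    proof -
      note wc = ideal.Icarr[OF MI w]
      consider "w \<in> sat M (PIdl y)" | "y \<in> sat M (PIdl w)"
        using arith M(1) wc yc unfolding arithmetical_ring_iff by blast
      then show ?thesis
      proof cases
        case 1
        then obtain s r where "s \<in> carrier R - M" "r \<in> carrier R" "s \<otimes> w = r \<otimes> y"
          by (auto simp: sat_iff PIdl_iff)
        then show ?thesis
          using ideal_cancel_unit[OF II unit wc] ideal_mult[OF II y(1)] by metis
      next
        case 2
        then obtain s r where s: "s \<in> carrier R - M" and r: "r \<in> carrier R" and eq: "s \<otimes> y = r \<otimes> w"
          by (auto simp: sat_iff PIdl_iff)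
        \<comment> \<open>Up to a unit \<open>y\<close> is \<open>r \<otimes> w\<close>, and
          \<open>y\<close> is outside \<open>M \<cdot> M\<close>. So \<open>r\<close> is a unit and
          \<open>w\<close> is a multiple of \<open>y\<close>.\<close>
        have "r \<notin> M"
        proof
          assume "r \<in> M"
          then have "s \<otimes> y \<in> M \<cdot> M" unfolding eq using w by (rule ideal_prod.prod)
          then show False
            using ideal_cancel_unit[OF ideal_prod_is_ideal[OF MI MI] unit[OF s] yc] y(2) by blast
        qed
        then have "r \<in> Units R" using unit r by blast
        moreover have "r \<otimes> w \<in> I" using ideal_mult[OF II y(1), of s] s unfolding eq by blast
        ultimately show ?thesis using ideal_cancel_unit[OF II _ wc] by blast
      qed
    qed
    then have "I = M" using M(2) by blast
    then show ?thesis using prime_in_prime_products[OF M'] by simp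
  qed
qed

section \<open>Implications between the three conditions\<close>

lemma general_ZPI_imp_arithmetical:
  assumes "general_ZPI_ring R" shows "arithmetical_ring R"
proof (rule arithmetical_ring_of_sat_dichotomy)
  have PP: "I \<in> prime_products R" if "ideal I R" for I
    using assms that general_ZPI_ring_iff by blast
  fix M a assume M: "maximalideal M R" and a: "a \<in> carrier R"
  obtain x where "x \<in> M" "M \<subseteq> sat M (PIdl x)"
    using prime_locally_principal[OF PP maximalideal_prime[OF M]] by blast
  then show "a \<in> sat M {\<zero>} \<or> (\<exists>n::nat. sat M (PIdl a) = sat M (M [^]\<^bsub>ideals_set R\<^esub> n))"
    by (rule sat_dichotomy_of_locally_principal[OF M _ _ a PP[OF cgenideal_ideal[OF a]]])
qed

lemma general_ZPI_imp_OAF: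
  assumes "general_ZPI_ring R" shows "OAF_ring R"
  unfolding OAF_ring_def
proof (intro allI impI)
  fix I assume I: "proper_ideal I R"
  then have "I \<in> prime_products R" using assms general_ZPI_ring_iff by (auto simp: proper_ideal_def)
  then have "I \<in> ideal_products R {J. OA_ideal J R}"
    by induction (auto intro: ideal_products.intros primeideal_OA_ideal)
  then show "has_OA_factorization R I" using has_OA_factorization_iff[OF I] by blast
qed

text \<open>Principal ideals become products of primes first; the local dichotomy then carries this
  to all ideals through \<open>ideal_in_prime_products\<close>.\<close>

lemma arithmetical_principal_OA_imp_general_ZPI:
  assumes arith: "arithmetical_ring R"
    and OA: "\<And>I. principalideal I R \<Longrightarrow> proper_ideal I R \<Longrightarrow> has_OA_factorization R I"
  shows "general_ZPI_ring R"
proof -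
  have PP: "PIdl a \<in> prime_products R" if a: "a \<in> carrier R" for a
  proof (cases "PIdl a = carrier R")
    case True
    then show ?thesis using ideal_products.one[of R] by simp
  next
    case False
    then have proper: "proper_ideal (PIdl a) R" using cgenideal_ideal[OF a] by (simp add: proper_ideal_def)
    have "has_OA_factorization R (PIdl a)"
      by (rule OA[OF cgenideal_is_principalideal[OF a] proper])
    then have "PIdl a \<in> ideal_products R {J. OA_ideal J R}" using has_OA_factorization_iff[OF proper] by blast
    \<comment> \<open>Each OA-factor is replaced by a product of primes, and
      \<open>ideal_products_trans\<close> joins these products.\<close>
    then show ?thesis
      by (rule ideal_products_trans[rotated 2])
        (use OA_ideal_in_prime_products[OF arith] primeideal_ideal in auto)
  qed
  have "a \<in> sat M {\<zero>} \<or> (\<exists>n::nat. sat M (PIdl a) = sat M (M [^]\<^bsub>ideals_set R\<^esub> n))"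
    if M: "maximalideal M R" and a: "a \<in> carrier R" for M a
  proof -
    obtain x where "x \<in> M" "M \<subseteq> sat M (PIdl x)"
      using arithmetical_maximal_locally_principal[OF M _ PP] arith M
      unfolding arithmetical_ring_iff by blast
    then show ?thesis by (rule sat_dichotomy_of_locally_principal[OF M _ _ a PP[OF a]])
  qed
  then show ?thesis
    unfolding general_ZPI_ring_iff using ideal_in_prime_products PP by blast
qed

end

theorem theorem2p8:
  fixes R :: "('a, 'b) ring_scheme" (structure)
  assumes "cring R" and "\<one> \<noteq> \<zero>"
  shows "(general_ZPI_ring R \<longleftrightarrow> arithmetical_ring R \<and> OAF_ring R) \<and>
    (arithmetical_ring R \<and> OAF_ring R \<longleftrightarrow>
      arithmetical_ring R \<and>
      (\<forall>I. principalideal I R \<and> proper_ideal I R \<longrightarrow> has_OA_factorization R I))"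
proof -
  interpret cring R by fact
  have "arithmetical_ring R \<and> OAF_ring R" if "general_ZPI_ring R"
    using that general_ZPI_imp_arithmetical general_ZPI_imp_OAF by blast
  moreover have "general_ZPI_ring R" if "arithmetical_ring R"
    "\<forall>I. principalideal I R \<and> proper_ideal I R \<longrightarrow> has_OA_factorization R I"
    using that arithmetical_principal_OA_imp_general_ZPI by blast
  \<comment> \<open>The step from (2) to (3) is specialization to principal ideals, which closes the
    cycle.\<close>
  ultimately show ?thesis unfolding OAF_ring_def by blast
qed

end
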